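(* Let $q$ be a prime power, $n,m\ge1$, let $\alpha$ be a composition of $n$ and $d$ an integer. Let $\gamma$ be a generator of the cyclic group $C=\mathbb{F}_{q^m}^\times$ and $\zeta\in\mathbb{C}^\times$ a primitive $(q^m-1)$st root of unity. Then $$\bigl|\{x\in X_\alpha:\gamma^d(x)=x\}\bigr|=\bigl[C_{\alpha,m}(t)\bigr]_{t=\zeta^d}.$$ In other words, the triple $(X_\alpha,C_{\alpha,m}(t),C)$ exhibits the cyclic sieving phenomenon.
   Context: A composition $\alpha=(\alpha_1,\dots,\alpha_\ell)$ of $n$ has positive integer parts summing to $n$. Weak compositions $\beta=(\beta_1,\dots,\beta_\ell)$ have nonnegative integer parts; $\beta\le\alpha$ means $\beta_i\le\alpha_i$ for all $i$; $|\beta|=\sum_i\beta_i$; $B_i=\beta_1+\cdots+\beta_i$, $B_0=0$. For $|\beta|\le m$, $Y_\beta$ is the set of $(\beta,m-|\beta|)$-flags in $\mathbb{F}_{q^m}$, i.e. towers $0=V_{B_0}\subset V_{B_1}\subset\cdots\subset V_{B_\ell}\subset\mathbb{F}_{q^m}$ of $\mathbb{F}_q$-subspaces with $\dim_{\mathbb{F}_q}V_{B_i}=B_i$. $X_\alpha=\bigsqcup_{\beta\le\alpha,\,|\beta|\le m}Y_\beta$. The group $C=\mathbb{F}_{q^m}^\times$ acts on $X_\alpha$ by multiplication: $c\cdot(V_{B_i})_i=(cV_{B_i})_i$. The polynomial $C_{\alpha,m}(t)$ is $$C_{\alpha,m}(t)=\sum_{\substack{\beta\le\alpha\\|\beta|\le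 m}}t^{\sum_{i=1}^\ell(\alpha_i-\beta_i)(q^m-q^{B_i})}\begin{bmatrix}m\\ \beta,m-|\beta|\end{bmatrix}_{q,t},\quad \begin{bmatrix}m\\ \beta,m-|\beta|\end{bmatrix}_{q,t}=\frac{\prod_{j=0}^{|\beta|-1}(1-t^{q^m-q^j})}{\prod_{i=1}^{\ell}\prod_{j=0}^{\beta_i-1}\bigl(1-t^{q^{B_i}-q^{B_{i-1}+j}}\bigr)},$$ where each $(q,t)$-multinomial is a polynomial in $t$ (so evaluation at $t=\zeta^d$ makes sense). *)

theory Defs
  imports
    "HOL-Algebra.Embedded_Algebras"
    "HOL-Algebra.Multiplicative_Group"
    "HOL-Algebra.Group_Action"
    "HOL-Algebra.Elementary_Groups"
    "HOL-Library.Disjoint_Sets"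
    "HOL-Number_Theory.Prime_Powers"
    "HOL-Computational_Algebra.Polynomial"
    Complex_Main
begin

section \<open>Compositions\<close>

definition composition :: "nat \<Rightarrow> nat list \<Rightarrow> bool" where
  "composition n \<alpha> \<longleftrightarrow> (\<forall>a\<in>set \<alpha>. 0 < a) \<and> sum_list \<alpha> = n"

text \<open>
  Lists are indexed from 0, so the part \<open>\<beta>\<^sub>i\<close> of the usual notation is \<open>\<beta> ! (i - 1)\<close>,
  whereas \<open>B\<^sub>i\<close> is \<open>psum \<beta> i\<close> for \<open>0 \<le> i \<le> length \<beta>\<close>.
\<close>

definition psum :: "nat list \<Rightarrow> nat \<Rightarrow> nat" where
  "psum \<beta> i = sum_list (take i \<beta>)"

definition sub_compositions :: "nat list \<Rightarrow> nat \<Rightarrow> nat list set" where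
  "sub_compositions \<alpha> m = {\<beta>. list_all2 (\<le>) \<beta> \<alpha> \<and> sum_list \<beta> \<le> m}"

lemma finite_sub_compositions: "finite (sub_compositions \<alpha> m)"
proof (rule finite_subset)
  have "x \<le> m" if "x \<in> set \<beta>" "sum_list \<beta> \<le> m" for x :: nat and \<beta>
    using member_le_sum_list[OF that(1)] that(2) by simp
  thus "sub_compositions \<alpha> m \<subseteq> {\<beta>. set \<beta> \<subseteq> {..m} \<and> length \<beta> = length \<alpha>}"
    by (auto simp: sub_compositions_def dest: list_all2_lengthD)
  show "finite {\<beta>. set \<beta> \<subseteq> {..m} \<and> length \<beta> = length \<alpha>}"
    by (rule finite_lists_length_eq) simp
qed


section \<open>Flags\<close>

text \<open>
  \<open>L\<close> plays the role of the field with \<open>q^m\<close> elements and \<open>K\<close> that of its subfield with \<open>q\<close>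
  elements.  A flag is the list \<open>[V\<^bsub>B\<^sub>0\<^esub>, \<dots>, V\<^bsub>B\<^sub>\<ell>\<^esub>]\<close>.  Its inclusions are weak, since
  consecutive members coincide where \<open>\<beta>\<close> has a zero part.  The locale predicate
  \<open>subalgebra K V L\<close> of HOL-Algebra says that \<open>V\<close> is a \<open>K\<close>-linear subspace of \<open>L\<close>
  (no closure under multiplication is involved).
\<close>

definition flags :: "('a, 'b) ring_scheme \<Rightarrow> 'a set \<Rightarrow> nat list \<Rightarrow> 'a set list set" where
  "flags L K \<beta> =
     {F. length F = Suc (length \<beta>) \<and>
         (\<forall>i\<le>length \<beta>. subalgebra K (F ! i) L \<and> ring.dimension L (psum \<beta> i) K (F ! i)) \<and>
         (\<forall>i<length \<beta>. F ! i \<subseteq> F ! Suc i)}"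

definition partial_flags :: "('a, 'b) ring_scheme \<Rightarrow> 'a set \<Rightarrow> nat list \<Rightarrow> nat \<Rightarrow> 'a set list set" where
  "partial_flags L K \<alpha> m = (\<Union>\<beta>\<in>sub_compositions \<alpha> m. flags L K \<beta>)"

lemma flags_disjoint:
  assumes "field L" "subfield K L" and len: "length \<beta> = length \<beta>'"
    and F: "F \<in> flags L K \<beta>" "F \<in> flags L K \<beta>'"
  shows "\<beta> = \<beta>'"
proof (rule nth_equalityI[OF len])
  interpret field L by fact
  have ps: "psum \<beta> i = psum \<beta>' i" if "i \<le> length \<beta>" for i
    using F that len dimension_is_inj[OF assms(2)] by (auto simp: flags_def)
  fix i assume i: "i < length \<beta>"
  have "psum \<beta> (Suc i) = psum \<beta> i + \<beta> ! i" "psum \<beta>' (Suc i) = psum \<beta>' i + \<beta>' ! i"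
    using i len by (simp_all add: psum_def take_Suc_conv_app_nth)
  with ps[of i] ps[of "Suc i"] i show "\<beta> ! i = \<beta>' ! i" by simp
qed

text \<open>
  Hence the union defining \<^const>\<open>partial_flags\<close> is disjoint.
\<close>

lemma disjoint_family_flags:
  assumes "field L" "subfield K L"
  shows "disjoint_family_on (flags L K) (sub_compositions \<alpha> m)"
  unfolding disjoint_family_on_def
proof (intro ballI impI)
  fix \<beta> \<beta>' assume b: "\<beta> \<in> sub_compositions \<alpha> m" "\<beta>' \<in> sub_compositions \<alpha> m" "\<beta> \<noteq> \<beta>'"
  hence "length \<beta> = length \<beta>'"
    by (auto simp: sub_compositions_def dest!: list_all2_lengthD)
  thus "flags L K \<beta> \<inter> flags L K \<beta>' = {}"
    using flags_disjoint[OF assms] b(3) by blast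
qed

text \<open>The \<open>restrict\<close> is required by \<^const>\<open>BijGroup\<close>, whose elements are extensional functions.\<close>

definition flag_action ::
    "('a, 'b) ring_scheme \<Rightarrow> 'a set \<Rightarrow> nat list \<Rightarrow> nat \<Rightarrow> 'a \<Rightarrow> 'a set list \<Rightarrow> 'a set list" where
  "flag_action L K \<alpha> m c = (\<lambda>F\<in>partial_flags L K \<alpha> m. map (\<lambda>V. c <#\<^bsub>L\<^esub> V) F)"


section \<open>The polynomials\<close>

definition qt_num :: "nat \<Rightarrow> nat \<Rightarrow> nat list \<Rightarrow> 'r::comm_ring_1 \<Rightarrow> 'r" where
  "qt_num q m \<beta> t = (\<Prod>j<sum_list \<beta>. 1 - t ^ (q ^ m - q ^ j))"

definition qt_den :: "nat \<Rightarrow> nat list \<Rightarrow> 'r::comm_ring_1 \<Rightarrow> 'r" where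
  "qt_den q \<beta> t =
     (\<Prod>i<length \<beta>. \<Prod>j<\<beta> ! i. 1 - t ^ (q ^ psum \<beta> (Suc i) - q ^ (psum \<beta> i + j)))"

text \<open>
  The division of integer polynomials below is exact: see \<open>qt_multinomial_exact\<close>.
\<close>

definition qt_multinomial :: "nat \<Rightarrow> nat \<Rightarrow> nat list \<Rightarrow> int poly" where
  "qt_multinomial q m \<beta> = qt_num q m \<beta> [:0, 1:] div qt_den q \<beta> [:0, 1:]"

definition C_poly :: "nat \<Rightarrow> nat list \<Rightarrow> nat \<Rightarrow> int poly" where
  "C_poly q \<alpha> m =
     (\<Sum>\<beta>\<in>sub_compositions \<alpha> m.
        Polynomial.monom 1 (\<Sum>i<length \<alpha>. (\<alpha> ! i - \<beta> ! i) * (q ^ m - q ^ psum \<beta> (Suc i)))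
        * qt_multinomial q m \<beta>)"

lemma qt_binomial_dvd:
  fixes t :: "'r::comm_ring_1"
  assumes "k \<le> n" "0 < q"
  shows "(\<Prod>j<k. 1 - t ^ (q ^ k - q ^ j)) dvd (\<Prod>j<k. 1 - t ^ (q ^ n - q ^ j))"
  using assms(1)
proof (induction n arbitrary: k t)
  case 0
  then show ?case by simp
next
  case (Suc n)
  define D where "D = (\<lambda>n k (t::'r). \<Prod>j<k. 1 - t ^ (q ^ n - q ^ j))"
  have shift: "D (Suc a) (Suc b) t = (1 - t ^ (q ^ Suc a - 1)) * D a b (t ^ q)" for a b t
    unfolding D_def by (subst prod.lessThan_Suc_shift)
      (simp add: power_mult[symmetric] diff_mult_distrib2)
  show ?case
  proof (cases "k = Suc n \<or> k = 0")
    case True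
    then show ?thesis by auto
  next
    case False
    then obtain l where k: "k = Suc l" and l: "Suc l \<le> n"
      using Suc.prems by (cases k) auto
    have "q ^ k \<le> q ^ Suc n" "1 \<le> q ^ k"
      using \<open>0 < q\<close> Suc.prems power_increasing[of k "Suc n" q] by simp_all
    hence "(q ^ Suc n - 1) = (q ^ k - 1) + (q ^ Suc n - q ^ k)"
      by linarith
    hence e: "1 - t ^ (q ^ Suc n - 1)
        = (1 - t ^ (q ^ k - 1)) + t ^ (q ^ k - 1) * (1 - t ^ (q ^ Suc n - q ^ k))"
      by (simp only: power_add) (simp add: algebra_simps)
    have h: "(1 - t ^ (q ^ Suc n - q ^ k)) * D n l (t ^ q) = D n k (t ^ q)"
      unfolding D_def k
      by (simp add: power_mult[symmetric] diff_mult_distrib2 mult.commute)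
    have "D (Suc n) k t = (1 - t ^ (q ^ Suc n - 1)) * D n l (t ^ q)"
      unfolding k by (rule shift)
    hence dec: "D (Suc n) k t
        = (1 - t ^ (q ^ k - 1)) * D n l (t ^ q) + t ^ (q ^ k - 1) * D n k (t ^ q)"
      by (simp only: e distrib_right mult.assoc h)
    have "D l l (t ^ q) dvd D n l (t ^ q)"
      unfolding D_def using Suc.IH[of l "t ^ q"] l by simp
    hence "D k k t dvd (1 - t ^ (q ^ k - 1)) * D n l (t ^ q)"
      unfolding k shift by (simp add: mult_dvd_mono)
    moreover have "D k k t dvd D k k (t ^ q)"
      unfolding D_def
    proof (rule prod_dvd_prod)
      fix j
      have "(t ^ q) ^ e = (t ^ e) ^ q" for e
        by (simp only: power_mult[symmetric] mult.commute)
      thus "1 - t ^ (q ^ k - q ^ j) dvd 1 - (t ^ q) ^ (q ^ k - q ^ j)"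
        by (simp only: one_diff_power_eq[of _ q] dvd_triv_left)
    qed
    hence "D k k t dvd D n k (t ^ q)"
      using Suc.IH[of k "t ^ q"] l unfolding D_def k by (meson dvd_trans)
    ultimately have "D k k t dvd D (Suc n) k t"
      unfolding dec by (simp add: dvd_mult)
    thus ?thesis unfolding D_def .
  qed
qed

lemma qt_den_dvd_qt_num:
  fixes t :: "'r::comm_ring_1"
  assumes "sum_list \<beta> \<le> m" "0 < q"
  shows "qt_den q \<beta> t dvd qt_num q m \<beta> t"
  using assms(1)
proof (induction \<beta> rule: rev_induct)
  case Nil
  then show ?case by (simp add: qt_den_def)
next
  case (snoc b \<beta>)
  let ?s = "sum_list \<beta>"
  have den: "qt_den q (\<beta> @ [b]) t
      = qt_den q \<beta> t * (\<Prod>j<b. 1 - t ^ (q ^ (?s + b) - q ^ (?s + j)))"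
    unfolding qt_den_def by (simp add: psum_def nth_append)
  have "(\<Prod>j<?s + b. f j) = (\<Prod>j<?s. f j) * (\<Prod>j<b. f (?s + j))" for f :: "nat \<Rightarrow> 'r"
    by (induction b) (simp_all add: mult.assoc)
  hence num: "qt_num q m (\<beta> @ [b]) t
      = qt_num q m \<beta> t * (\<Prod>j<b. 1 - t ^ (q ^ m - q ^ (?s + j)))"
    unfolding qt_num_def by simp
  have "(\<Prod>j<b. 1 - (t ^ q ^ ?s) ^ (q ^ b - q ^ j))
      dvd (\<Prod>j<b. 1 - (t ^ q ^ ?s) ^ (q ^ (m - ?s) - q ^ j))"
    using snoc.prems \<open>0 < q\<close> by (intro qt_binomial_dvd) auto
  moreover have "q ^ ?s * q ^ (m - ?s) = q ^ m"
    using snoc.prems by (simp flip: power_add)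
  ultimately have "(\<Prod>j<b. 1 - t ^ (q ^ (?s + b) - q ^ (?s + j)))
      dvd (\<Prod>j<b. 1 - t ^ (q ^ m - q ^ (?s + j)))"
    by (simp add: power_mult[symmetric] diff_mult_distrib2 power_add)
  thus ?case
    using snoc unfolding den num by (intro mult_dvd_mono) auto
qed

lemma qt_multinomial_exact:
  assumes "sum_list \<beta> \<le> m" "0 < q"
  shows "qt_multinomial q m \<beta> * qt_den q \<beta> [:0, 1:] = qt_num q m \<beta> [:0, 1:]"
  unfolding qt_multinomial_def by (rule dvd_div_mult_self[OF qt_den_dvd_qt_num[OF assms]])


section \<open>Cyclic sieving\<close>

definition primitive_root_of_unity :: "nat \<Rightarrow> complex \<Rightarrow> bool" where
  "primitive_root_of_unity N \<zeta> \<longleftrightarrow> \<zeta> ^ N = 1 \<and> (\<forall>k. 0 < k \<and> k < N \<longrightarrow> \<zeta> ^ k \<noteq> 1)"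

definition cyclic_generator :: "('g, 'h) monoid_scheme \<Rightarrow> 'g \<Rightarrow> bool" where
  "cyclic_generator C \<gamma> \<longleftrightarrow> \<gamma> \<in> carrier C \<and> generate C {\<gamma>} = carrier C"

definition eval_complex :: "int poly \<Rightarrow> complex \<Rightarrow> complex" where
  "eval_complex f z = poly (map_poly of_int f) z"

definition exhibits_cyclic_sieving ::
    "('g, 'h) monoid_scheme \<Rightarrow> 'x set \<Rightarrow> ('g \<Rightarrow> 'x \<Rightarrow> 'x) \<Rightarrow> int poly \<Rightarrow> bool" where
  "exhibits_cyclic_sieving C X \<phi> f \<longleftrightarrow>
     cyclic_group C \<and> finite (carrier C) \<and> finite X \<and> group_action C X \<phi> \<and>
     (\<forall>\<gamma> \<zeta>. cyclic_generator C \<gamma> \<longrightarrow> primitive_root_of_unity (Coset.order C) \<zeta> \<longrightarrow>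
        (\<forall>d::int. of_nat (card (invariants X \<phi> (\<gamma> [^]\<^bsub>C\<^esub> d))) = eval_complex f (\<zeta> powi d)))"

end

theory Submission
  imports Defs "HOL-Algebra.Generated_Fields"
begin

text \<open>
  Put \<open>c = \<gamma>\<^sup>d\<close> and \<open>\<omega> = \<zeta>\<^sup>d\<close>, so that \<open>\<omega>\<close> and \<open>c\<close> have the same order, and let \<open>E\<close> be the subfield
  generated by \<open>K\<close> and \<open>c\<close>, with \<open>q^e\<close> elements.  A \<open>K\<close>-subspace \<open>V\<close> satisfies \<open>c V = V\<close> iff it is an
  \<open>E\<close>-subspace, so the fixed flags of type \<open>\<beta>\<close> are the flags of \<open>E\<close>-subspaces: there are none
  unless \<open>e\<close> divides every part of \<open>\<beta>\<close>, and otherwise they are counted by a \<open>q^e\<close>-multinomial.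
  On the other side, the Frobenius map shows that \<open>\<omega>^(q^a - q^b) = 1\<close> iff \<open>e\<close> divides \<open>a - b\<close>.  Hence at
  \<open>t = \<omega>\<close> the numerator of the \<open>(q,t)\<close>-multinomial has a zero of higher order than the denominator
  unless \<open>e\<close> divides every part, in which case the vanishing factors contribute the quotients
  \<open>(q^m - q^k) / (q^B - q^k)\<close> with \<open>e\<close> dividing \<open>k\<close>, all other factors cancel, and the power of \<open>t\<close> in
  front is 1.
\<close>

section \<open>The Frobenius map\<close>

context cring
begin

text \<open>Induction on \<open>n\<close>: multiplying the expansion by \<open>x\<close> and by
  \<open>y\<close> gives two sums whose coefficients add up by Pascal's rule.\<close>

lemma binomial_expansion:
  assumes x: "x \<in> carrier R" and y: "y \<in> carrier R"
  shows "(x \<oplus> y) [^] (n::nat) = (\<Oplus>k\<in>{..n}. [(n choose k)] \<cdot> (x [^] k \<otimes> y [^] (n - k)))"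
proof (induction n)
  case 0
  show ?case by (simp add: x y)
next
  case (Suc n)
  \<comment> \<open>\<open>f\<close> collects the terms multiplied by \<open>y\<close> and
    \<open>g\<close> those multiplied by \<open>x\<close>, with the index moved up by one. The added
    end terms \<open>f (Suc n)\<close> and \<open>g 0\<close> are zero, so both sums run over
    \<open>{..Suc n}\<close>.\<close>
  define f where "f k = [(n choose k)] \<cdot> (x [^] k \<otimes> y [^] (Suc n - k))" for k
  define g where "g k = (if k = 0 then \<zero> else [(n choose (k - 1))] \<cdot> (x [^] k \<otimes> y [^] (Suc n - k)))" for k
  have fc: "f k \<in> carrier R" and gc: "g k \<in> carrier R" for k
    by (auto simp: f_def g_def x y)
  then have f: "f \<in> A \<rightarrow> carrier R" and g: "g \<in> A \<rightarrow> carrier R" for A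
    by auto
  have t: "[(n choose k)] \<cdot> (x [^] k \<otimes> y [^] (n - k)) \<in> carrier R" for k
    by (simp add: x y)
  have gS: "g (Suc k) = [(n choose k)] \<cdot> (x [^] k \<otimes> y [^] (n - k)) \<otimes> x" for k
    using x y by (simp add: g_def add_pow_ldistr add_pow_rdistr m_ac)
  have fy: "[(n choose k)] \<cdot> (x [^] k \<otimes> y [^] (n - k)) \<otimes> y = f k" if "k \<le> n" for k
    using x y that by (simp add: f_def add_pow_ldistr add_pow_rdistr m_ac Suc_diff_le)
  have "(\<Oplus>k\<in>{..Suc n}. g k) = (\<Oplus>k\<in>{..n}. g (Suc k)) \<oplus> g 0"
    by (rule finsum_Suc2) (rule g)
  also have "\<dots> = (\<Oplus>k\<in>{..n}. [(n choose k)] \<cdot> (x [^] k \<otimes> y [^] (n - k))) \<otimes> x"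
    unfolding gS using x y by (simp add: g_def finsum_ldistr)
  finally have G: "(\<Oplus>k\<in>{..Suc n}. g k) = (x \<oplus> y) [^] n \<otimes> x"
    by (simp only: Suc)
  have "(\<Oplus>k\<in>{..Suc n}. f k) = f (Suc n) \<oplus> (\<Oplus>k\<in>{..n}. f k)"
    by (rule finsum_Suc) (rule f)
  also have "\<dots> = (\<Oplus>k\<in>{..n}. f k)"
    using f by (simp add: f_def x y binomial_eq_0)
  also have "\<dots> = (\<Oplus>k\<in>{..n}. [(n choose k)] \<cdot> (x [^] k \<otimes> y [^] (n - k)) \<otimes> y)"
    by (rule finsum_cong') (auto simp: fy fc)
  also have "\<dots> = (\<Oplus>k\<in>{..n}. [(n choose k)] \<cdot> (x [^] k \<otimes> y [^] (n - k))) \<otimes> y"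
    using x y by (simp add: finsum_ldistr)
  finally have F: "(\<Oplus>k\<in>{..Suc n}. f k) = (x \<oplus> y) [^] n \<otimes> y"
    by (simp only: Suc)
  have "(x \<oplus> y) [^] Suc n = (\<Oplus>k\<in>{..Suc n}. g k) \<oplus> (\<Oplus>k\<in>{..Suc n}. f k)"
    unfolding F G using x y by (simp add: r_distr)
  also have "\<dots> = (\<Oplus>k\<in>{..Suc n}. g k \<oplus> f k)"
    by (rule finsum_addf[symmetric]) (use f g in auto)
  also have "\<dots> = (\<Oplus>k\<in>{..Suc n}. [(Suc n choose k)] \<cdot> (x [^] k \<otimes> y [^] (Suc n - k)))"
  proof (rule finsum_cong')
    fix k
    show "g k \<oplus> f k = [(Suc n choose k)] \<cdot> (x [^] k \<otimes> y [^] (Suc n - k))"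
      by (cases k) (simp_all add: f_def g_def x y add.nat_pow_mult)
  qed (auto simp: x y)
  finally show ?case .
qed

text \<open>For exponent \<open>p\<close> all inner binomial coefficients are divisible by
  \<open>p\<close> and vanish in the ring; iterating this \<open>k\<close> times gives the general
  exponent.\<close>

lemma add_pow_prime_power:
  fixes p :: nat
  assumes p: "Factorial_Ring.prime p" "[p] \<cdot> \<one> = \<zero>" and x: "x \<in> carrier R" and y: "y \<in> carrier R"
  shows "(x \<oplus> y) [^] (p ^ k) = x [^] (p ^ k) \<oplus> y [^] (p ^ k)"
proof (induction k)
  case 0
  then show ?case by (simp add: x y)
next
  case (Suc k)
  have *: "(x \<oplus> y) [^] p = x [^] p \<oplus> y [^] p" if x: "x \<in> carrier R" and y: "y \<in> carrier R" for x y
  proof -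
    have z: "[(p choose j)] \<cdot> (x [^] j \<otimes> y [^] (p - j)) = \<zero>" if "0 < j" "j < p" for j
    proof -
      have "p dvd p choose j"
        using that p(1) by (intro dvd_choose_prime) auto
      then obtain i where i: "p choose j = p * i" by blast
      define z where "z = x [^] j \<otimes> y [^] (p - j)"
      have zc: "z \<in> carrier R" by (simp add: z_def x y)
      have "[p] \<cdot> z = ([p] \<cdot> \<one>) \<otimes> z"
        using zc by (simp add: add_pow_ldistr)
      then have "[p] \<cdot> z = \<zero>" using zc p(2) by simp
      then show ?thesis
        unfolding i z_def[symmetric] using zc by (simp flip: add.nat_pow_pow)
    qed
    obtain r where r: "p = Suc r" using prime_gt_0_nat[OF p(1)] by (cases p) auto
    let ?f = "\<lambda>j. [(p choose j)] \<cdot> (x [^] j \<otimes> y [^] (p - j))"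
    have f: "?f \<in> A \<rightarrow> carrier R" for A by (auto simp: x y)
    have "(x \<oplus> y) [^] p = (\<Oplus>j\<in>{..Suc r}. ?f j)"
      using binomial_expansion[OF x y, of p] unfolding r .
    also have "\<dots> = ?f (Suc r) \<oplus> (\<Oplus>j\<in>{..r}. ?f j)"
      by (rule finsum_Suc) (rule f)
    also have "(\<Oplus>j\<in>{..r}. ?f j) = (\<Oplus>j\<in>{..r}. if 0 = j then y [^] p else \<zero>)"
    proof (rule finsum_cong')
      fix j assume "j \<in> {..r}"
      then show "?f j = (if 0 = j then y [^] p else \<zero>)"
        using z[of j] by (cases "j = 0") (auto simp: r x y)
    qed (auto simp: y)
    also have "\<dots> = y [^] p"
      by (rule add.finprod_singleton) (auto simp: y)
    finally show ?thesis by (simp add: r x y)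
  qed
  have "(x \<oplus> y) [^] (p ^ Suc k) = ((x \<oplus> y) [^] (p ^ k)) [^] p"
    using x y by (simp add: nat_pow_pow mult.commute)
  also have "\<dots> = (x [^] (p ^ k)) [^] p \<oplus> (y [^] (p ^ k)) [^] p"
    unfolding Suc using x y by (intro *) auto
  finally show ?case
    using x y by (simp add: nat_pow_pow mult.commute)
qed

end

text \<open>Lagrange in the additive group annihilates \<one> by \<open>p ^ k\<close>. In the ring
  this multiple is the \<open>k\<close>-th power of the \<open>p\<close>-fold sum of \<one>, and
  there are no zero divisors.\<close>

lemma (in domain) add_pow_prime_eq_zero:
  assumes "card (carrier R) = p ^ k"
  shows "[p] \<cdot> \<one> = \<zero>"
proof -
  have "[(p ^ j)] \<cdot> \<one> = \<zero> \<Longrightarrow> [p] \<cdot> \<one> = \<zero>" for j :: nat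
  proof (induction j)
    case 0
    then show ?case by simp
  next
    case (Suc j)
    have "[(p ^ Suc j)] \<cdot> \<one> = [(p ^ j)] \<cdot> ([p] \<cdot> \<one>)"
      by (simp add: add.nat_pow_pow)
    also have "\<dots> = ([(p ^ j)] \<cdot> \<one>) \<otimes> ([p] \<cdot> \<one>)"
      by (simp add: add_pow_ldistr)
    finally show ?case using Suc by (auto dest: integral)
  qed
  moreover have "[(p ^ k)] \<cdot> \<one> = \<zero>"
    using add.pow_order_eq_1[of \<one>] assms by (simp add: Coset.order_def)
  ultimately show ?thesis by blast
qed

lemma (in field) pow_card_eq_self:
  assumes fin: "finite (carrier R)" and x: "x \<in> carrier R"
  shows "x [^] card (carrier R) = x"
proof -
  have "card (carrier R) \<noteq> 0" using fin x by auto
  then obtain n where n: "card (carrier R) = Suc n" by (cases "card (carrier R)") auto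
  show ?thesis
  proof (cases "x = \<zero>")
    case True
    then show ?thesis by (simp add: n)
  next
    case False
    interpret M: group "mult_of R" by (rule field_mult_group)
    have "x [^] n = \<one>"
      using M.pow_order_eq_1[of x] order_mult_of[OF fin] x False n
      by (simp add: Coset.order_def nat_pow_mult_of)
    then show ?thesis using x by (simp add: n)
  qed
qed


section \<open>Subspaces of a finite field\<close>

context field
begin

text \<open>The map \<open>(k, u) \<mapsto> k \<otimes> v \<oplus> u\<close> on
  \<open>K \<times> V\<close> is injective: a collision with distinct scalars would, after division
  by their difference, put \<open>v\<close> into \<open>V\<close>.\<close>

lemma card_line_extension:
  assumes K: "subfield K R" and V: "subalgebra K V R" and v: "v \<in> carrier R" "v \<notin> V"
  shows "card (line_extension K v V) = card K * card V"
proof -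
  note Kc = subfieldE(3)[OF K] and Vc = subalgebra_in_carrier[OF V]
  have Vg: "subgroup V (add_monoid R)" using V by (rule subalgebra.axioms)
  have inj: "inj_on (\<lambda>(k, u). k \<otimes> v \<oplus> u) (K \<times> V)"
  proof (rule inj_onI, clarify)
    fix k u k' u'
    assume a: "k \<in> K" "u \<in> V" "k' \<in> K" "u' \<in> V" and e: "k \<otimes> v \<oplus> u = k' \<otimes> v \<oplus> u'"
    have c: "k \<in> carrier R" "k' \<in> carrier R" "u \<in> carrier R" "u' \<in> carrier R"
      using a Kc Vc by auto
    have "(k \<ominus> k') \<otimes> v = (k \<otimes> v \<oplus> u) \<ominus> k' \<otimes> v \<ominus> u"
      using c v(1) by algebra
    also have "\<dots> = u' \<ominus> u"
      unfolding e using c v(1) by algebra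
    finally have d: "(k \<ominus> k') \<otimes> v = u' \<ominus> u" .
    have dV: "u' \<ominus> u \<in> V"
      unfolding minus_eq using add.subgroupE(3,4)[OF Vg] a by blast
    have dK: "k \<ominus> k' \<in> K"
      unfolding minus_eq using subringE(5,7)[OF subfieldE(1)[OF K]] a by blast
    have "k = k'"
    proof (rule ccontr)
      assume "k \<noteq> k'"
      then have nz: "k \<ominus> k' \<in> K - {\<zero>}" using dK c by auto
      then have "inv (k \<ominus> k') \<in> K" and i: "inv (k \<ominus> k') \<otimes> (k \<ominus> k') = \<one>"
        using subfield_m_inv[OF K nz] by auto
      then have "inv (k \<ominus> k') \<otimes> ((k \<ominus> k') \<otimes> v) \<in> V"
        using dV d subalgebra.smult_closed[OF V] by simp
      also have "inv (k \<ominus> k') \<otimes> ((k \<ominus> k') \<otimes> v) = v"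
        using i v(1) c \<open>inv (k \<ominus> k') \<in> K\<close> Kc by (simp flip: m_assoc add: subset_iff)
      finally show False using v(2) by simp
    qed
    moreover from this e have "u = u'"
      using c v(1) by simp
    ultimately show "k = k' \<and> u = u'" by simp
  qed
  have "line_extension K v V = (\<lambda>(k, u). k \<otimes> v \<oplus> u) ` (K \<times> V)"
    by (force simp: line_extension_mem_iff)
  then show ?thesis
    using card_image[OF inj] by (simp add: card_cartesian_product)
qed

lemma card_eq_power_dimension:
  assumes K: "subfield K R" and V: "dimension n K V"
  shows "card V = card K ^ n"
  using V K
proof (induction rule: dimension.induct)
  case zero_dim
  then show ?case by simp
next
  case (Suc_dim v V n K)
  have "subalgebra K V R"
    using Suc_dim by (blast intro: finite_dimension_imp_subalgebra finite_dimensionI)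
  then show ?case
    using card_line_extension Suc_dim by simp
qed

lemma subalgebra_line_extension:
  assumes K: "subfield K R" and V: "subalgebra K V R" and v: "v \<in> carrier R"
  shows "subalgebra K (line_extension K v V) R"
  using line_extension_is_subgroup[OF K subalgebra.axioms(1)[OF V] v]
    line_extension_smult_closed[OF K subalgebra.smult_closed[OF V] subalgebra_in_carrier[OF V] v]
  unfolding subalgebra_def subalgebra_axioms_def by blast

lemma finite_dimension_if_finite:
  assumes fin: "finite (carrier R)" and K: "subfield K R" and V: "subalgebra K V R"
  shows "finite_dimension K V"
proof -
  obtain xs where xs: "set xs = carrier R" using finite_list[OF fin] by blast
  have "Span K xs = carrier R"
    using Span_base_incl[OF K, of xs] Span_in_carrier[OF subfieldE(3)[OF K], of xs] xs by blast
  then have "finite_dimension K (carrier R)"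
    using Span_finite_dimension[OF K, of xs] xs by simp
  then show ?thesis
    using subalbegra_incl_imp_finite_dimension[OF K _ V subalgebra_in_carrier[OF V]] by simp
qed

lemma card_subfield_ge_2:
  assumes "finite (carrier R)" "subfield K R"
  shows "card K \<ge> 2"
proof -
  have "{\<zero>, \<one>} \<subseteq> K" "finite K"
    using subringE(2,3)[OF subfieldE(1)[OF assms(2)]] subfieldE(3)[OF assms(2)] assms(1)
    by (auto intro: finite_subset)
  then have "card {\<zero>, \<one>} \<le> card K" by (intro card_mono)
  then show ?thesis by simp
qed

text \<open>Replaces dimensions by cardinalities, which do not depend on the base field; this allows
  subspaces over \<open>K\<close> and over a larger field to be measured by the same number.\<close>

lemma dimension_iff_card:
  assumes fin: "finite (carrier R)" and K: "subfield K R" and V: "subalgebra K V R"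
  shows "dimension n K V \<longleftrightarrow> card V = card K ^ n"
proof
  assume "card V = card K ^ n"
  moreover obtain k where k: "dimension k K V"
    using finite_dimension_if_finite[OF assms] by auto
  ultimately have "card K ^ k = card K ^ n"
    using card_eq_power_dimension[OF K] by simp
  then have "k = n" using card_subfield_ge_2[OF fin K] by simp
  then show "dimension n K V" using k by simp
qed (rule card_eq_power_dimension[OF K])

text \<open>
  Double counting of the pairs \<open>(W, x)\<close> with \<open>x \<in> W - V\<close>: a subspace contains both \<open>V\<close> and \<open>x\<close> iff it
  contains the line extension, so the count for \<open>V\<close> reduces to the one for larger subspaces.
\<close>

lemma card_superspaces:
  assumes fin: "finite (carrier R)" and K: "subfield K R" and V: "subalgebra K V R"
  shows "card {W. subalgebra K W R \<and> V \<subseteq> W \<and> card W = card V * card K ^ b}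
           * (\<Prod>k<b. card V * card K ^ b - card V * card K ^ k)
         = (\<Prod>k<b. card (carrier R) - card V * card K ^ k)"
  using V
proof (induction b arbitrary: V)
  case 0
  have "W = V" if "subalgebra K W R" "V \<subseteq> W" "card W = card V" for W
    using card_subset_eq[of W V] finite_subset[OF subalgebra_in_carrier[OF that(1)] fin] that by simp
  then have "{W. subalgebra K W R \<and> V \<subseteq> W \<and> card W = card V} = {V}"
    using 0 by blast
  then show ?case by simp
next
  case (Suc b)
  let ?q = "card K"
  \<comment> \<open>\<open>P\<close> is the left-hand product for a line extension of
    \<open>V\<close> and exponent \<open>b\<close>, and also the product for \<open>V\<close> and
    \<open>Suc b\<close> without its factor at \<open>k = 0\<close>. Multiplying by it makes the
    induction hypothesis applicable to every summand.\<close>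
  define P where "P = (\<Prod>k<b. card V * ?q ^ Suc b - card V * ?q ^ Suc k)"
  define S where "S V b = {W. subalgebra K W R \<and> V \<subseteq> W \<and> card W = card V * ?q ^ b}" for V b
  have finS: "finite (S V b)" for V b
    by (rule finite_subset[of _ "Pow (carrier R)"]) (auto simp: S_def fin dest: subalgebra_in_carrier)
  have finV: "finite V" using Suc.prems fin by (auto dest: subalgebra_in_carrier intro: finite_subset)
  have ext: "{W \<in> S V (Suc b). x \<in> W} = S (line_extension K x V) b"
    if x: "x \<in> carrier R - V" for x
  proof -
    have "line_extension K x V \<subseteq> W \<longleftrightarrow> V \<subseteq> W \<and> x \<in> W" if W: "subalgebra K W R" for W
    proof
      have c: "V \<subseteq> carrier R" using Suc.prems by (rule subalgebra_in_carrier)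
      assume le: "line_extension K x V \<subseteq> W"
      have "v \<in> line_extension K x V" if "v \<in> V" for v
        unfolding line_extension_mem_iff
        using that c x subringE(2)[OF subfieldE(1)[OF K]]
        by (intro bexI[of _ \<zero>] bexI[of _ v]) auto
      moreover have "x \<in> line_extension K x V"
        unfolding line_extension_mem_iff
        using x subringE(3)[OF subfieldE(1)[OF K]]
          add.subgroupE(1)[OF subalgebra.axioms(1)[OF Suc.prems]]
          subgroup.one_closed[OF subalgebra.axioms(1)[OF Suc.prems]]
        by (intro bexI[of _ \<one>] bexI[of _ \<zero>]) auto
      ultimately show "V \<subseteq> W \<and> x \<in> W" using le by blast
    next
      assume "V \<subseteq> W \<and> x \<in> W"
      then show "line_extension K x V \<subseteq> W"
        using subalgebra.smult_closed[OF W] add.subgroupE(4)[OF subalgebra.axioms(1)[OF W]]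
        unfolding subset_iff line_extension_mem_iff by blast
    qed
    then show ?thesis
      using card_line_extension[OF K Suc.prems] x by (auto simp: S_def mult_ac)
  qed
  have "card (S V (Suc b)) * (card V * ?q ^ Suc b - card V)
      = (\<Sum>W\<in>S V (Suc b). card {x \<in> carrier R - V. x \<in> W})"
  proof -
    have "card {x \<in> carrier R - V. x \<in> W} = card V * ?q ^ Suc b - card V" if "W \<in> S V (Suc b)" for W
    proof -
      have "{x \<in> carrier R - V. x \<in> W} = W - V"
        using that by (auto simp: S_def dest: subalgebra_in_carrier)
      then show ?thesis
        using that finV by (simp add: S_def card_Diff_subset)
    qed
    then show ?thesis by simp
  qed
  also have "\<dots> = (\<Sum>x\<in>carrier R - V. card (S (line_extension K x V) b))"
    by (rule sum_multicount_gen) (use ext finS fin in auto)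
  finally have "card (S V (Suc b)) * (card V * ?q ^ Suc b - card V) * P
      = (\<Sum>x\<in>carrier R - V. card (S (line_extension K x V) b) * P)"
    by (simp add: sum_distrib_right)
  also have "\<dots> = (\<Sum>x\<in>carrier R - V. \<Prod>k<b. card (carrier R) - card V * ?q ^ Suc k)"
  proof (rule sum.cong[OF refl])
    fix x assume x: "x \<in> carrier R - V"
    show "card (S (line_extension K x V) b) * P
        = (\<Prod>k<b. card (carrier R) - card V * ?q ^ Suc k)"
      using Suc.IH[OF subalgebra_line_extension[OF K Suc.prems, of x]] x
        card_line_extension[OF K Suc.prems, of x]
      by (simp add: S_def P_def mult_ac)
  qed
  also have "\<dots> = (card (carrier R) - card V) * (\<Prod>k<b. card (carrier R) - card V * ?q ^ Suc k)"
    using finV Suc.prems by (simp add: card_Diff_subset subalgebra_in_carrier)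
  finally show ?case
    unfolding prod.lessThan_Suc_shift P_def S_def by (simp add: mult.assoc)
qed

end


section \<open>The subfield generated by an element\<close>

context field
begin

text \<open>The inverse of a nonzero element of a field with \<open>n + 2\<close> elements is its
  \<open>n\<close>-th power, which stays in the subring.\<close>

lemma finite_subring_is_subfield:
  assumes fin: "finite (carrier R)" and S: "subring S R"
  shows "subfield S R"
proof (rule subfieldI'[OF S])
  fix x assume x: "x \<in> S - {\<zero>}"
  have xc: "x \<in> carrier R" using x subringE(1)[OF S] by auto
  have "card {\<zero>, \<one>} \<le> card (carrier R)" using fin by (intro card_mono) auto
  then obtain n where n: "card (carrier R) = Suc (Suc n)"
    by (auto simp: le_Suc_ex numeral_2_eq_2 dest!: le_Suc_ex)
  have "x [^] Suc (Suc n) = x" using pow_card_eq_self[OF fin xc] n by simp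
  then have "(x [^] n \<otimes> x) \<otimes> x = \<one> \<otimes> x" using xc by simp
  then have "x [^] n \<otimes> x = \<one>"
    using x xc by (subst (asm) m_rcancel) auto
  then have "inv x = x [^] n" using xc by (intro comm_inv_char) (auto simp: m_comm)
  moreover have "x [^] n \<in> S"
    by (induction n) (use x subringE[OF S] in auto)
  ultimately show "inv x \<in> S" by simp
qed

text \<open>The multipliers of \<open>V\<close> form the largest ring acting on it. Over a finite
  field this is a subfield, so stability of \<open>V\<close> under some elements passes to the field
  they generate.\<close>

lemma multiplier_subring:
  assumes V: "subgroup V (add_monoid R)"
  shows "subring {x \<in> carrier R. \<forall>v\<in>V. x \<otimes> v \<in> V} R"
proof -
  have c: "v \<in> carrier R" if "v \<in> V" for v using that add.subgroupE(1)[OF V] by auto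
  show ?thesis
    using add.subgroupE(3,4)[OF V]
    by (intro subringI) (auto simp: c l_minus l_distr m_assoc)
qed

lemma card_l_coset:
  assumes V: "V \<subseteq> carrier R" and c: "c \<in> carrier R - {\<zero>}"
  shows "card (c <# V) = card V"
proof -
  have "c <# V = (\<lambda>v. c \<otimes> v) ` V" by (auto simp: l_coset_def)
  moreover have "inj_on (\<lambda>v. c \<otimes> v) V"
    using c V by (auto intro!: inj_onI dest: m_lcancel[THEN iffD1, rotated 3])
  ultimately show ?thesis by (simp add: card_image)
qed

text \<open>If \<open>c\<close> fixes \<open>V\<close>, then the multipliers of \<open>V\<close> are
  a subfield containing \<open>c\<close> and \<open>K\<close>. Conversely
  \<open>c <# V \<subseteq> V\<close> is an equality because both sides have the same finite
  cardinality.\<close>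

lemma l_coset_eq_iff_subalgebra_generate_field:
  assumes fin: "finite (carrier R)" and K: "subfield K R" and V: "subalgebra K V R"
    and c: "c \<in> carrier R - {\<zero>}"
  shows "c <# V = V \<longleftrightarrow> subalgebra (generate_field R (insert c K)) V R"
proof
  have Vc: "V \<subseteq> carrier R" using V by (rule subalgebra_in_carrier)
  have Kc: "K \<subseteq> carrier R" using K by (rule subfieldE(3))
  {
    assume e: "c <# V = V"
    let ?M = "{x \<in> carrier R. \<forall>v\<in>V. x \<otimes> v \<in> V}"
    have "subfield ?M R"
      using V by (intro finite_subring_is_subfield fin multiplier_subring subalgebra.axioms)
    moreover have "insert c K \<subseteq> ?M"
      using e c Kc subalgebra.smult_closed[OF V] by (auto simp: l_coset_def)
    ultimately have "generate_field R (insert c K) \<subseteq> ?M"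
      using c Kc by (intro generate_field_min_subfield1) auto
    then show "subalgebra (generate_field R (insert c K)) V R"
      using subalgebra.axioms(1)[OF V] unfolding subalgebra_def subalgebra_axioms_def by blast
  }
  {
    assume E: "subalgebra (generate_field R (insert c K)) V R"
    have "c \<in> generate_field R (insert c K)" by (simp add: generate_field.incl)
    then have "c <# V \<subseteq> V"
      using subalgebra.smult_closed[OF E] by (auto simp: l_coset_def)
    moreover have "card (c <# V) = card V" using Vc c by (rule card_l_coset)
    ultimately show "c <# V = V"
      using Vc fin by (intro card_subset_eq) (auto intro: finite_subset)
  }
qed

lemma pow_power_eq_self:
  assumes "x \<in> carrier R" "x [^] (n::nat) = x"
  shows "x [^] (n ^ j) = x"
proof (induction j)
  case (Suc j)
  have "x [^] (n ^ Suc j) = (x [^] n) [^] (n ^ j)"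
    using assms(1) by (simp add: nat_pow_pow)
  then show ?case using Suc assms by simp
qed (use assms in simp)

lemma pow_card_subfield_eq_self:
  assumes "finite (carrier R)" "subfield K R" "x \<in> K"
  shows "x [^] card K = x"
proof -
  interpret K: field "R \<lparr>carrier := K\<rparr>" using assms(2) by (rule subfield_iff)
  have "finite K" using assms(1) subfieldE(3)[OF assms(2)] by (rule finite_subset[rotated])
  then show ?thesis
    using K.pow_card_eq_self[of x] assms(3) nat_pow_consistent by simp
qed

text \<open>The \<open>p ^ k\<close>-th power map is a ring endomorphism, so its fixed points are
  closed under all ring operations.\<close>

lemma fixed_points_pow_subring:
  assumes p: "Factorial_Ring.prime p" "[(p::nat)] \<cdot> \<one> = \<zero>"
  shows "subring {x \<in> carrier R. x [^] (p ^ k) = x} R"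
proof -
  have n: "(\<ominus> x) [^] (p ^ k) = \<ominus> (x [^] (p ^ k))" if x: "x \<in> carrier R" for x
  proof -
    have "x [^] (p ^ k) \<oplus> (\<ominus> x) [^] (p ^ k) = (x \<oplus> \<ominus> x) [^] (p ^ k)"
      by (rule add_pow_prime_power[OF p, symmetric]) (use x in auto)
    also have "\<dots> = \<zero>"
      using x prime_gt_0_nat[OF p(1)] by (simp add: r_neg nat_pow_zero)
    finally show ?thesis
      using x by (metis minus_equality add.m_comm a_inv_closed nat_pow_closed)
  qed
  show ?thesis
    by (intro subringI) (auto simp: n nat_pow_distrib add_pow_prime_power[OF p])
qed

text \<open>Since \<open>card K ^ e\<close> as exponent fixes \<open>c\<close>, only
  \<open>r = a mod e\<close> matters. If \<open>r\<close> were positive, the fixed points of the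
  \<open>card K ^ r\<close>-th power would form a subfield containing \<open>K\<close> and
  \<open>c\<close>, hence the generated field, but with at most \<open>card K ^ r\<close> elements,
  which contradicts \<open>r < e\<close>.\<close>

lemma pow_eq_self_iff_degree_dvd:
  assumes p: "Factorial_Ring.prime p" and L: "card (carrier R) = p ^ l"
    and K: "subfield K R" "card K = p ^ k"
    and c: "c \<in> carrier R"
    and E: "card (generate_field R (insert c K)) = card K ^ e"
  shows "c [^] (card K ^ a) = c \<longleftrightarrow> e dvd a"
proof
  let ?E = "generate_field R (insert c K)"
  have fin: "finite (carrier R)"
    using L prime_gt_0_nat[OF p] by (intro card_ge_0_finite) simp
  have p0: "[p] \<cdot> \<one> = \<zero>" using L by (rule add_pow_prime_eq_zero)
  have Kc: "insert c K \<subseteq> carrier R" using subfieldE(3)[OF K(1)] c by auto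
  have Es: "subfield ?E R" using Kc by (rule generate_field_is_subfield)
  have cE: "c \<in> ?E" by (simp add: generate_field.incl)
  have ce: "c [^] ((card K ^ e) ^ j) = c" for j
    using pow_power_eq_self[OF c] pow_card_subfield_eq_self[OF fin Es cE] E by simp
  {
    assume "e dvd a"
    then obtain j where "a = e * j" by blast
    then show "c [^] (card K ^ a) = c" using ce[of j] by (simp add: power_mult)
  }
  assume a: "c [^] (card K ^ a) = c"
  have q2: "card K \<ge> 2" using fin K(1) by (rule card_subfield_ge_2)
  have e0: "e > 0"
    using card_subfield_ge_2[OF fin Es] E by (cases e) auto
  define r where "r = a mod e"
  have "card K ^ a = (card K ^ e) ^ (a div e) * card K ^ r"
    unfolding r_def by (simp flip: power_mult power_add)
  then have r: "c [^] (card K ^ r) = c"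
    using a ce[of "a div e"] c by (simp flip: nat_pow_pow)
  have "r = 0"
  proof (rule ccontr)
    assume r0: "r \<noteq> 0"
    let ?F = "{x \<in> carrier R. x [^] (card K ^ r) = x}"
    have "subfield ?F R"
      using fixed_points_pow_subring[OF p p0, of "k * r"] K(2)
      by (intro finite_subring_is_subfield fin) (simp add: power_mult)
    moreover have "insert c K \<subseteq> ?F"
      using Kc r pow_power_eq_self[OF _ pow_card_subfield_eq_self[OF fin K(1)]] by auto
    ultimately have EF: "?E \<subseteq> ?F" by (rule generate_field_min_subfield1[OF Kc])
    define n where "n = card K ^ r - 1"
    have n: "card K ^ r = Suc n" "n \<noteq> 0"
      using q2 r0 one_less_power[of "card K" r] by (auto simp: n_def)
    \<comment> \<open>Nonzero fixed points are roots of \<open>X ^ n - 1\<close>, of which there are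
      at most \<open>n\<close>.\<close>
    have "?E - {\<zero>} \<subseteq> {x \<in> carrier R. x [^] n = \<one>}"
    proof
      fix x assume x: "x \<in> ?E - {\<zero>}"
      then have xc: "x \<in> carrier R" and "x [^] n \<otimes> x = \<one> \<otimes> x" using EF n by auto
      then have "x [^] n = \<one>" using x by (subst (asm) m_rcancel) auto
      then show "x \<in> {x \<in> carrier R. x [^] n = \<one>}" using xc by simp
    qed
    then have "card (?E - {\<zero>}) \<le> card {x \<in> carrier R. x [^] n = \<one>}"
      using fin by (intro card_mono) auto
    also have "\<dots> \<le> n" by (rule num_roots_le_deg[OF fin n(2)])
    finally have "card K ^ e \<le> card K ^ r"
      using E n subringE(2)[OF subfieldE(1)[OF Es]] by (simp add: card_Diff_singleton_if)
    then have "e \<le> r" using q2 by simp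
    then show False using mod_less_divisor[OF e0, of a] by (simp add: r_def)
  qed
  then show "e dvd a" by (simp add: r_def dvd_eq_mod_eq_0)
qed

text \<open>Multiplying by \<open>c [^] (card K ^ b)\<close> turns the equation into equality of two
  Frobenius powers of \<open>c\<close>. Cancelling the injective \<open>card K ^ b\<close>-th power
  map leaves the preceding criterion for \<open>a - b\<close>.\<close>

lemma pow_diff_eq_one_iff_degree_dvd:
  assumes p: "Factorial_Ring.prime p" and L: "card (carrier R) = card K ^ m" "m > 0"
    and K: "subfield K R" "card K = p ^ k"
    and c: "c \<in> carrier R - {\<zero>}"
    and E: "card (generate_field R (insert c K)) = card K ^ e"
    and ab: "b \<le> a"
  shows "c [^] (card K ^ a - card K ^ b) = \<one> \<longleftrightarrow> e dvd a - b"
proof -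
  have L': "card (carrier R) = p ^ (k * m)" using L K by (simp add: power_mult)
  have fin: "finite (carrier R)"
    using L' prime_gt_0_nat[OF p] by (intro card_ge_0_finite) simp
  have q2: "card K \<ge> 2" using fin K(1) by (rule card_subfield_ge_2)
  have inj: "x = y" if x: "x \<in> carrier R" and y: "y \<in> carrier R"
    and e: "x [^] (card K ^ b) = y [^] (card K ^ b)" for x y
  proof -
    \<comment> \<open>The \<open>card K ^ (m * b)\<close>-th power map is the identity, so the
      exponent \<open>card K ^ (m * b - b)\<close> inverts \<open>card K ^ b\<close>;
      \<open>m > 0\<close> makes the difference genuine.\<close>
    have "z = (z [^] (card K ^ b)) [^] (card K ^ (m * b - b))" if z: "z \<in> carrier R" for z
    proof -
      have "(z [^] (card K ^ b)) [^] (card K ^ (m * b - b)) = z [^] ((card K ^ m) ^ b)"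
        using z L(2) by (simp add: nat_pow_pow flip: power_add power_mult)
      also have "\<dots> = z"
        using pow_card_eq_self[OF fin z] L(1) pow_power_eq_self[OF z, of "card K ^ m" b] by simp
      finally show ?thesis by simp
    qed
    from this[OF x] this[OF y] e show ?thesis by simp
  qed
  have le: "card K ^ b \<le> card K ^ a" using ab q2 by (intro power_increasing) auto
  have cb: "c [^] (card K ^ b) \<noteq> \<zero>" using Units_pow_closed[of c "card K ^ b"] c by (simp add: field_Units)
  have "c [^] (card K ^ a - card K ^ b) \<otimes> c [^] (card K ^ b) = c [^] (card K ^ a)"
    using c le by (simp add: nat_pow_mult)
  then have "c [^] (card K ^ a - card K ^ b) = \<one>
      \<longleftrightarrow> c [^] (card K ^ a) = c [^] (card K ^ b)"
    using c cb m_rcancel[of "c [^] (card K ^ b)" "c [^] (card K ^ a - card K ^ b)" \<one>] by auto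
  also have "c [^] (card K ^ a) = (c [^] (card K ^ (a - b))) [^] (card K ^ b)"
    using c ab by (simp add: nat_pow_pow flip: power_add)
  also have "\<dots> = c [^] (card K ^ b) \<longleftrightarrow> c [^] (card K ^ (a - b)) = c"
    using inj c by auto
  also have "\<dots> \<longleftrightarrow> e dvd a - b"
    using c by (intro pow_eq_self_iff_degree_dvd[OF p L' K _ E]) auto
  finally show ?thesis .
qed

end


section \<open>Quotients of products of factors \<open>1 - X^n\<close> at a point\<close>

text \<open>A root \<open>w\<close> of \<open>1 - X ^ n\<close> is simple, and the cofactor of
  \<open>X - w\<close> takes at \<open>w\<close> the value of the derivative,
  \<open>- n * w ^ (n - 1) = - n / w\<close>.\<close>

lemma one_minus_X_power_factor:
  fixes w :: complex
  assumes "n > 0"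
  obtains h where "1 - [:0, 1:] ^ n = (if w ^ n = 1 then [:- w, 1:] else 1) * h"
    and "poly h w = (if w ^ n = 1 then - of_nat n / w else 1 - w ^ n)"
proof (cases "w ^ n = 1")
  case True
  then have w: "w \<noteq> 0" using assms by (auto simp: zero_power)
  have "poly (1 - [:0, 1:] ^ n) w = 0" using True by simp
  then have "[:- w, 1:] dvd 1 - [:0, 1:] ^ n" by (simp only: poly_eq_0_iff_dvd)
  then obtain h where h: "1 - [:0, 1:] ^ n = [:- w, 1:] * h" by (elim dvdE)
  have "poly (pderiv (1 - [:0, 1:] ^ n)) w = - of_nat n * w ^ (n - 1)"
    by (simp add: pderiv_diff pderiv_power pderiv_pCons)
  also have "w ^ (n - 1) = 1 / w"
    using True w assms by (cases n) (auto simp: field_simps)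
  finally have "poly (pderiv ([:- w, 1:] * h)) w = - of_nat n / w"
    unfolding h by simp
  moreover have "poly (pderiv ([:- w, 1:] * h)) w = poly h w"
    unfolding pderiv_mult by (simp add: pderiv_pCons)
  ultimately have "poly h w = - of_nat n / w" by simp
  with h True show ?thesis by (intro that[of h]) auto
next
  case False
  then show ?thesis by (intro that[of "1 - [:0, 1:] ^ n"]) auto
qed

context
  fixes I :: "'i set" and M N :: "'i \<Rightarrow> nat" and F :: "complex poly" and w :: complex
  assumes fin: "finite I"
    and M: "\<And>x. x \<in> I \<Longrightarrow> M x > 0" and N: "\<And>x. x \<in> I \<Longrightarrow> N x > 0"
    and F: "F * (\<Prod>x\<in>I. 1 - [:0, 1:] ^ M x) = (\<Prod>x\<in>I. 1 - [:0, 1:] ^ N x)"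
begin

lemma prod_one_minus_X_power_factor:
  assumes n: "\<And>x. x \<in> I \<Longrightarrow> n x > 0"
  obtains h where "(\<Prod>x\<in>I. 1 - [:0, 1:] ^ n x) = [:- w, 1:] ^ card {x \<in> I. w ^ n x = 1} * h"
    and "poly h w = (\<Prod>x\<in>I. if w ^ n x = 1 then - of_nat (n x) / w else 1 - w ^ n x)"
proof -
  have "\<exists>h. \<forall>x\<in>I. 1 - [:0, 1:] ^ n x = (if w ^ n x = 1 then [:- w, 1:] else 1) * h x
      \<and> poly (h x) w = (if w ^ n x = 1 then - of_nat (n x) / w else 1 - w ^ n x)"
  proof (rule bchoice, rule ballI)
    fix x assume "x \<in> I"
    from one_minus_X_power_factor[OF n[OF this], of w]
    show "\<exists>h. 1 - [:0, 1:] ^ n x = (if w ^ n x = 1 then [:- w, 1:] else 1) * h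
        \<and> poly h w = (if w ^ n x = 1 then - of_nat (n x) / w else 1 - w ^ n x)"
      by blast
  qed
  then obtain h where h: "\<And>x. x \<in> I \<Longrightarrow> 1 - [:0, 1:] ^ n x = (if w ^ n x = 1 then [:- w, 1:] else 1) * h x"
    "\<And>x. x \<in> I \<Longrightarrow> poly (h x) w = (if w ^ n x = 1 then - of_nat (n x) / w else 1 - w ^ n x)"
    by blast
  have "(\<Prod>x\<in>I. 1 - [:0, 1:] ^ n x)
      = (\<Prod>x\<in>I. if w ^ n x = 1 then [:- w, 1:] else 1) * prod h I"
    by (simp add: h(1) flip: prod.distrib)
  also have "(\<Prod>x\<in>I. if w ^ n x = 1 then [:- w, 1:] else 1) = [:- w, 1:] ^ card {x \<in> I. w ^ n x = 1}"
    using fin by (simp add: prod.If_cases Int_def)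
  finally show ?thesis
    by (rule that) (simp add: poly_prod h(2))
qed

text \<open>After the common power of \<open>X - w\<close> is cancelled, a positive power remains on
  the right, while the rest of the denominator does not vanish at \<open>w\<close>.\<close>

lemma poly_quotient_eq_0:
  assumes "card {x \<in> I. w ^ M x = 1} < card {x \<in> I. w ^ N x = 1}"
  shows "poly F w = 0"
proof -
  let ?m = "card {x \<in> I. w ^ M x = 1}" and ?n = "card {x \<in> I. w ^ N x = 1}"
  obtain g where g: "(\<Prod>x\<in>I. 1 - [:0, 1:] ^ M x) = [:- w, 1:] ^ ?m * g"
    "poly g w = (\<Prod>x\<in>I. if w ^ M x = 1 then - of_nat (M x) / w else 1 - w ^ M x)"
    by (rule prod_one_minus_X_power_factor[OF M])
  obtain h where h: "(\<Prod>x\<in>I. 1 - [:0, 1:] ^ N x) = [:- w, 1:] ^ ?n * h"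
    by (rule prod_one_minus_X_power_factor[OF N])
  have "[:- w, 1:] ^ ?m * (F * g) = [:- w, 1:] ^ ?m * ([:- w, 1:] ^ (?n - ?m) * h)"
    using F assms unfolding g h by (simp add: mult_ac flip: power_add mult.assoc)
  then have "F * g = [:- w, 1:] ^ (?n - ?m) * h"
    by (subst (asm) mult_cancel_left) auto
  then have "poly (F * g) w = poly ([:- w, 1:] ^ (?n - ?m) * h) w" by simp
  then have "poly F w * poly g w = 0" using assms by (simp add: zero_power)
  moreover have "poly g w \<noteq> 0"
  proof -
    have "w \<noteq> 0" if "x \<in> I" "w ^ M x = 1" for x
      using that M by (auto simp: zero_power)
    then show ?thesis unfolding g(2) using fin by (auto simp: prod_zero_iff dest: M)
  qed
  ultimately show ?thesis by simp
qed

text \<open>Numerator and denominator have the same vanishing factors. The other factors agree at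
  \<open>w\<close> and cancel, and a vanishing pair contributes the quotient of
  \<open>- N x / w\<close> by \<open>- M x / w\<close>; the statement is multiplied out to avoid
  division.\<close>

lemma poly_quotient_eq:
  assumes eq: "\<And>x. x \<in> I \<Longrightarrow> w ^ M x = w ^ N x"
  shows "poly F w * (\<Prod>x\<in>{x \<in> I. w ^ M x = 1}. of_nat (M x)) = (\<Prod>x\<in>{x \<in> I. w ^ M x = 1}. of_nat (N x))"
proof -
  let ?m = "card {x \<in> I. w ^ M x = 1}"
  have mn: "{x \<in> I. w ^ N x = 1} = {x \<in> I. w ^ M x = 1}" using eq by auto
  obtain g where g: "(\<Prod>x\<in>I. 1 - [:0, 1:] ^ M x) = [:- w, 1:] ^ ?m * g"
    "poly g w = (\<Prod>x\<in>I. if w ^ M x = 1 then - of_nat (M x) / w else 1 - w ^ M x)"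
    by (rule prod_one_minus_X_power_factor[OF M])
  obtain h where h: "(\<Prod>x\<in>I. 1 - [:0, 1:] ^ N x) = [:- w, 1:] ^ ?m * h"
    "poly h w = (\<Prod>x\<in>I. if w ^ N x = 1 then - of_nat (N x) / w else 1 - w ^ N x)"
    by (rule prod_one_minus_X_power_factor[of N, unfolded mn, OF N])
  \<comment> \<open>\<open>u\<close> is the nonzero part shared by both sides; only the integers
    \<open>M x\<close> and \<open>N x\<close> distinguish them.\<close>
  define u where "u x = (if w ^ M x = 1 then - 1 / w else 1 - w ^ M x)" for x
  have "[:- w, 1:] ^ ?m * (F * g) = [:- w, 1:] ^ ?m * h"
    using F unfolding g h by (simp add: mult_ac)
  then have "F * g = h" by (subst (asm) mult_cancel_left) auto
  then have Fgh: "poly F w * poly g w = poly h w" by auto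
  have split: "(\<Prod>x\<in>I. if w ^ M x = 1 then - of_nat (n x) / w else 1 - w ^ M x)
      = prod u I * (\<Prod>x\<in>{x \<in> I. w ^ M x = 1}. of_nat (n x))" for n :: "'i \<Rightarrow> nat"
  proof -
    have "(\<Prod>x\<in>I. if w ^ M x = 1 then - of_nat (n x) / w else 1 - w ^ M x)
        = (\<Prod>x\<in>I. u x * (if w ^ M x = 1 then of_nat (n x) else 1))"
      by (intro prod.cong) (auto simp: u_def)
    then show ?thesis
      using fin by (simp add: prod.distrib prod.inter_filter)
  qed
  have hw: "poly h w = (\<Prod>x\<in>I. if w ^ M x = 1 then - of_nat (N x) / w else 1 - w ^ M x)"
    unfolding h(2) by (intro prod.cong) (auto simp: eq)
  have "w \<noteq> 0" if "x \<in> I" "w ^ M x = 1" for x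
    using that M by (auto simp: zero_power)
  then have "prod u I \<noteq> 0" using fin by (auto simp: u_def prod_zero_iff)
  then show ?thesis using Fgh unfolding g(2) hw split by simp
qed

end


section \<open>The multinomials at a root of unity\<close>

lemma card_multiples_greaterThanAtMost:
  assumes "e > 0"
  shows "card {j. 0 < j \<and> j \<le> n \<and> e dvd j} = n div e"
proof (induction n)
  case (Suc n)
  have "{j. 0 < j \<and> j \<le> Suc n \<and> e dvd j}
      = (if e dvd Suc n then insert (Suc n) {j. 0 < j \<and> j \<le> n \<and> e dvd j} else {j. 0 < j \<and> j \<le> n \<and> e dvd j})"
    by (auto simp: le_Suc_eq)
  then show ?case using Suc by (simp add: div_Suc dvd_eq_mod_eq_0)
qed auto

lemma card_codivisors_lessThan:
  assumes "e > 0"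
  shows "card {j. j < n \<and> e dvd n - j} = n div e"
proof -
  have "bij_betw (\<lambda>j. n - j) {j. j < n \<and> e dvd n - j} {j. 0 < j \<and> j \<le> n \<and> e dvd j}"
    by (rule bij_betw_byWitness[where f' = "\<lambda>j. n - j"]) auto
  then show ?thesis
    using card_multiples_greaterThanAtMost[OF assms] by (simp add: bij_betw_same_card)
qed

text \<open>Because 0 is counted, the number of multiples is \<open>n / e\<close> rounded up, in
  contrast to the count in \<open>card_codivisors_lessThan\<close>, which rounds down. This gap is
  what makes a multinomial vanish.\<close>

lemma le_mult_card_multiples_lessThan:
  assumes "e > 0"
  shows "n \<le> e * card {j. j < n \<and> e dvd j}"
proof (cases n)
  case (Suc k)
  have "{j. j < n \<and> e dvd j} = insert 0 {j. 0 < j \<and> j \<le> k \<and> e dvd j}"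
    using Suc by auto
  then have "card {j. j < n \<and> e dvd j} = Suc (k div e)"
    using card_multiples_greaterThanAtMost[OF assms] by simp
  moreover have "k < e * Suc (k div e)"
    using assms by (metis dividend_less_div_times mult.commute mult_Suc_right add.commute)
  ultimately show ?thesis using Suc by simp
qed simp

lemma psum_Suc: "i < length \<beta> \<Longrightarrow> psum \<beta> (Suc i) = psum \<beta> i + \<beta> ! i"
  by (simp add: psum_def take_Suc_conv_app_nth)

lemma psum_le_sum_list: "psum \<beta> i \<le> sum_list \<beta>"
  unfolding psum_def by (metis append_take_drop_id sum_list_append le_add1)

lemma sum_list_eq_sum_nth: "sum_list \<beta> = (\<Sum>i<length \<beta>. \<beta> ! i)"
  by (simp add: sum_list_sum_nth atLeast0LessThan)

lemma dvd_psum: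
  assumes "\<And>i. i < length \<beta> \<Longrightarrow> e dvd \<beta> ! i" "i \<le> length \<beta>"
  shows "e dvd psum \<beta> i"
  using assms(2) by (induction i) (auto simp: psum_Suc psum_def[of _ 0] assms(1))

text \<open>Consecutive blocks of lengths \<beta> \<open>! i\<close> tile the initial segment;
  appending a part adds one block at its end.\<close>

lemma bij_betw_psum:
  "bij_betw (\<lambda>(i, j). psum \<beta> i + j) (SIGMA i:{..<length \<beta>}. {..<\<beta> ! i}) {..<sum_list \<beta>}"
proof (induction \<beta> rule: rev_induct)
  case (snoc b \<beta>)
  let ?f = "\<lambda>(i, j). psum (\<beta> @ [b]) i + j"
  have "bij_betw ?f (SIGMA i:{..<length \<beta>}. {..<\<beta> ! i}) {..<sum_list \<beta>}"
    using snoc by (rule bij_betw_cong[THEN iffD1, rotated]) (auto simp: psum_def)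
  moreover have "bij_betw ?f ({length \<beta>} \<times> {..<b}) {sum_list \<beta>..<sum_list \<beta> + b}"
    by (rule bij_betw_byWitness[where f' = "\<lambda>k. (length \<beta>, k - sum_list \<beta>)"])
      (auto simp: psum_def)
  ultimately have "bij_betw ?f ((SIGMA i:{..<length \<beta>}. {..<\<beta> ! i}) \<union> ({length \<beta>} \<times> {..<b}))
      ({..<sum_list \<beta>} \<union> {sum_list \<beta>..<sum_list \<beta> + b})"
    by (rule bij_betw_combine) auto
  moreover have "(SIGMA i:{..<length \<beta>}. {..<\<beta> ! i}) \<union> ({length \<beta>} \<times> {..<b})
      = (SIGMA i:{..<length (\<beta> @ [b])}. {..<(\<beta> @ [b]) ! i})"
    by (auto simp: nth_append less_Suc_eq split: if_splits)
  moreover have "{..<sum_list \<beta>} \<union> {sum_list \<beta>..<sum_list \<beta> + b} = {..<sum_list (\<beta> @ [b])}"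
    by auto
  ultimately show ?case by simp
qed (simp add: bij_betw_def)

section \<open>Integer polynomials evaluated at complex numbers\<close>

lemma map_poly_of_int_mult:
  "map_poly of_int (f * g) = (map_poly of_int f * map_poly of_int g :: 'a::comm_ring_1 poly)"
  by (rule poly_eqI) (simp add: coeff_map_poly coeff_mult)

lemma map_poly_of_int_one_minus_X_power:
  "map_poly of_int (1 - [:0, 1:] ^ n) = (1 - [:0, 1:] ^ n :: 'a::comm_ring_1 poly)"
proof -
  have "map_poly of_int ([:0, 1:] ^ n) = ([:0, 1:] ^ n :: 'a poly)"
    by (induction n) (simp_all add: map_poly_of_int_mult map_poly_pCons)
  moreover have "map_poly of_int (f - g) = (map_poly of_int f - map_poly of_int g :: 'a poly)" for f g
    by (rule poly_eqI) (simp add: coeff_map_poly)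
  ultimately show ?thesis by simp
qed

lemma map_poly_of_int_prod:
  "map_poly of_int (\<Prod>x\<in>A. f x) = (\<Prod>x\<in>A. map_poly of_int (f x) :: 'a::comm_ring_1 poly)"
  by (induction A rule: infinite_finite_induct) (simp_all add: map_poly_of_int_mult)

lemma eval_complex_simps:
  "eval_complex (f * g) z = eval_complex f z * eval_complex g z"
  "eval_complex (Polynomial.monom 1 n) z = z ^ n"
  "eval_complex (sum h A) z = (\<Sum>x\<in>A. eval_complex (h x) z)"
proof -
  have add: "map_poly of_int (f + g) = (map_poly of_int f + map_poly of_int g :: complex poly)" for f g
    by (rule poly_eqI) (simp add: coeff_map_poly)
  show "eval_complex (sum h A) z = (\<Sum>x\<in>A. eval_complex (h x) z)"
    by (induction A rule: infinite_finite_induct) (simp_all add: eval_complex_def add)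
qed (simp_all add: eval_complex_def map_poly_of_int_mult map_poly_monom poly_monom)

text \<open>
  The numerator is a product over \<open>j < |\<beta>|\<close> and the denominator one over pairs \<open>(i, j)\<close> with \<open>j < \<beta>\<^sub>i\<close>.
  Writing the former index as \<open>B\<^sub>i + j\<close> makes the two comparable factor by factor.
\<close>

abbreviation cells :: "nat list \<Rightarrow> (nat \<times> nat) set" where
  "cells \<beta> \<equiv> SIGMA i:{..<length \<beta>}. {..<\<beta> ! i}"

definition den_exp :: "nat \<Rightarrow> nat list \<Rightarrow> nat \<times> nat \<Rightarrow> nat" where
  "den_exp q \<beta> = (\<lambda>(i, j). q ^ psum \<beta> (Suc i) - q ^ (psum \<beta> i + j))"

definition num_exp :: "nat \<Rightarrow> nat \<Rightarrow> nat list \<Rightarrow> nat \<times> nat \<Rightarrow> nat" where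
  "num_exp q m \<beta> = (\<lambda>(i, j). q ^ m - q ^ (psum \<beta> i + j))"

lemma qt_den_eq_prod_cells: "qt_den q \<beta> t = (\<Prod>x\<in>cells \<beta>. 1 - t ^ den_exp q \<beta> x)"
  unfolding qt_den_def by (subst prod.Sigma) (auto simp: den_exp_def case_prod_beta)

lemma qt_num_eq_prod_cells: "qt_num q m \<beta> t = (\<Prod>x\<in>cells \<beta>. 1 - t ^ num_exp q m \<beta> x)"
  unfolding qt_num_def prod.reindex_bij_betw[OF bij_betw_psum, symmetric]
  by (simp add: num_exp_def case_prod_beta)

text \<open>Exactness of the integer division, carried over to complex polynomials in the form that
  the quotient lemmas take as hypothesis \<open>F\<close>.\<close>

lemma qt_multinomial_times_den:
  assumes "sum_list \<beta> \<le> m" "0 < q"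
  shows "map_poly of_int (qt_multinomial q m \<beta>) * (\<Prod>x\<in>cells \<beta>. 1 - [:0, 1:] ^ den_exp q \<beta> x)
       = (\<Prod>x\<in>cells \<beta>. 1 - [:0, 1:] ^ num_exp q m \<beta> x :: complex poly)"
  using arg_cong[OF qt_multinomial_exact[OF assms], of "map_poly of_int :: _ \<Rightarrow> complex poly"]
  by (simp only: qt_den_eq_prod_cells qt_num_eq_prod_cells map_poly_of_int_mult
      map_poly_of_int_prod map_poly_of_int_one_minus_X_power)

section \<open>Vanishing and value of a single multinomial\<close>

context
  fixes q m e :: nat and w :: complex and \<beta> :: "nat list"
  assumes q: "2 \<le> q" and e: "0 < e" "e dvd m" and le: "sum_list \<beta> \<le> m"
    and w: "\<And>a b. b \<le> a \<Longrightarrow> w ^ (q ^ a - q ^ b) = 1 \<longleftrightarrow> e dvd a - b"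
begin

lemma den_exp_pos: "x \<in> cells \<beta> \<Longrightarrow> 0 < den_exp q \<beta> x"
  using q by (auto simp: den_exp_def psum_Suc intro!: power_strict_increasing)

lemma psum_less_if_cell:
  assumes "(i, j) \<in> cells \<beta>" shows "psum \<beta> i + j < m"
  using assms psum_le_sum_list[of \<beta> "Suc i"] le by (auto simp: psum_Suc)

lemma num_exp_pos: "x \<in> cells \<beta> \<Longrightarrow> 0 < num_exp q m \<beta> x"
  using q psum_less_if_cell by (auto simp: num_exp_def intro!: power_strict_increasing)

lemma pow_den_exp_eq_1_iff:
  "(i, j) \<in> cells \<beta> \<Longrightarrow> w ^ den_exp q \<beta> (i, j) = 1 \<longleftrightarrow> e dvd \<beta> ! i - j"
  by (simp add: den_exp_def psum_Suc w)

lemma pow_num_exp_eq_1_iff: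
  assumes "(i, j) \<in> cells \<beta>"
  shows "w ^ num_exp q m \<beta> (i, j) = 1 \<longleftrightarrow> e dvd psum \<beta> i + j"
  using psum_less_if_cell[OF assms] e
  by (auto simp: num_exp_def w dvd_diff_nat intro: dvd_diffD1)

text \<open>The denominator has as many vanishing factors as the sum of all \<beta>
  \<open>! i div e\<close>, the numerator at least \<open>sum_list\<close> \<beta> divided by
  \<open>e\<close>. The former is strictly smaller as soon as one part is not divisible by
  \<open>e\<close>.\<close>

lemma eval_qt_multinomial_eq_0:
  assumes "\<exists>i<length \<beta>. \<not> e dvd \<beta> ! i"
  shows "eval_complex (qt_multinomial q m \<beta>) w = 0"
proof -
  have "{x \<in> cells \<beta>. w ^ den_exp q \<beta> x = 1}
      = (SIGMA i:{..<length \<beta>}. {j. j < \<beta> ! i \<and> e dvd \<beta> ! i - j})"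
    using pow_den_exp_eq_1_iff by auto
  then have d: "card {x \<in> cells \<beta>. w ^ den_exp q \<beta> x = 1} = (\<Sum>i<length \<beta>. \<beta> ! i div e)"
    using e(1) by (simp add: card_codivisors_lessThan)
  \<comment> \<open>Since \<open>e\<close> divides \<open>m\<close>, a numerator factor vanishes
    exactly when its position \<open>psum\<close> \<beta> \<open>i + j\<close> is a multiple of
    \<open>e\<close>.\<close>
  have "bij_betw (\<lambda>(i, j). psum \<beta> i + j) {x \<in> cells \<beta>. w ^ num_exp q m \<beta> x = 1}
      {k. k < sum_list \<beta> \<and> e dvd k}"
    using bij_betw_Collect[OF bij_betw_psum[of \<beta>], of "\<lambda>k. e dvd k"
        "\<lambda>x. w ^ num_exp q m \<beta> x = 1"] pow_num_exp_eq_1_iff by auto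
  then have n: "card {x \<in> cells \<beta>. w ^ num_exp q m \<beta> x = 1} = card {k. k < sum_list \<beta> \<and> e dvd k}"
    by (rule bij_betw_same_card)
  have "e * (\<Sum>i<length \<beta>. \<beta> ! i div e) < (\<Sum>i<length \<beta>. \<beta> ! i)"
    unfolding sum_distrib_left
  proof (rule sum_strict_mono_ex1)
    show "\<exists>i\<in>{..<length \<beta>}. e * (\<beta> ! i div e) < \<beta> ! i"
      using assms by (metis dvd_triv_left lessThan_iff nat_less_le times_div_less_eq_dividend)
  qed auto
  also have "\<dots> \<le> e * card {k. k < sum_list \<beta> \<and> e dvd k}"
    unfolding sum_list_eq_sum_nth[symmetric] using e(1) by (rule le_mult_card_multiples_lessThan)
  finally have "card {x \<in> cells \<beta>. w ^ den_exp q \<beta> x = 1} < card {x \<in> cells \<beta>. w ^ num_exp q m \<beta> x = 1}"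
    unfolding d n by simp
  then show ?thesis
    unfolding eval_complex_def using q le
    by (intro poly_quotient_eq_0[OF _ den_exp_pos num_exp_pos qt_multinomial_times_den]) auto
qed

text \<open>Here \<open>e\<close> divides \<open>m\<close> and all partial sums, so the two
  exponents of a cell differ by \<open>q ^ m - q ^ psum\<close> \<beta> \<open>(Suc i)\<close>, on
  which \<open>w\<close> has power 1. The factors then match cell by cell, and the quotients of
  exponents remain at the cells with \<open>e dvd j\<close>.\<close>

lemma eval_qt_multinomial_mult_eq:
  assumes dvd: "\<And>i. i < length \<beta> \<Longrightarrow> e dvd \<beta> ! i"
  shows "eval_complex (qt_multinomial q m \<beta>) w
        * of_nat (\<Prod>i<length \<beta>. \<Prod>j\<in>{j. j < \<beta> ! i \<and> e dvd j}. den_exp q \<beta> (i, j))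
      = of_nat (\<Prod>i<length \<beta>. \<Prod>j\<in>{j. j < \<beta> ! i \<and> e dvd j}. num_exp q m \<beta> (i, j))"
proof -
  have eq: "w ^ den_exp q \<beta> x = w ^ num_exp q m \<beta> x" if x: "x \<in> cells \<beta>" for x
  proof -
    obtain i j where ij: "x = (i, j)" "i < length \<beta>" "j < \<beta> ! i" using x by auto
    have m: "psum \<beta> (Suc i) \<le> m" using psum_le_sum_list le by (rule order_trans)
    have "e dvd m - psum \<beta> (Suc i)"
      using dvd_psum[of \<beta> e "Suc i"] dvd ij e by simp
    moreover have "q ^ (psum \<beta> i + j) \<le> q ^ psum \<beta> (Suc i)" "q ^ psum \<beta> (Suc i) \<le> q ^ m"
      using q m ij by (auto intro!: power_increasing simp: psum_Suc)
    then have "num_exp q m \<beta> x = (q ^ m - q ^ psum \<beta> (Suc i)) + den_exp q \<beta> x"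
      by (simp add: num_exp_def den_exp_def ij)
    ultimately show ?thesis using w[OF m] by (simp add: power_add)
  qed
  have I: "{x \<in> cells \<beta>. w ^ den_exp q \<beta> x = 1}
      = (SIGMA i:{..<length \<beta>}. {j. j < \<beta> ! i \<and> e dvd j})"
    using pow_den_exp_eq_1_iff dvd by (auto simp: dvd_diff_nat intro: dvd_diffD1)
  have "eval_complex (qt_multinomial q m \<beta>) w
        * (\<Prod>x\<in>{x \<in> cells \<beta>. w ^ den_exp q \<beta> x = 1}. of_nat (den_exp q \<beta> x))
      = (\<Prod>x\<in>{x \<in> cells \<beta>. w ^ den_exp q \<beta> x = 1}. of_nat (num_exp q m \<beta> x))"
    unfolding eval_complex_def using q le
    by (intro poly_quotient_eq[OF _ den_exp_pos num_exp_pos qt_multinomial_times_den] eq) auto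
  then show ?thesis
    unfolding I by (simp add: prod.Sigma case_prod_beta)
qed

end


section \<open>Flags fixed by multiplication\<close>

text \<open>Sizes are prescribed as powers of \<open>q\<close>, independently of
  \<open>card E\<close>, so that subspaces over a larger field \<open>E\<close> are still indexed by
  the type \<beta> of the flags over \<open>K\<close>.\<close>

definition towers :: "('a, 'b) ring_scheme \<Rightarrow> 'a set \<Rightarrow> nat \<Rightarrow> nat list \<Rightarrow> 'a set list set" where
  "towers R E q \<beta> =
     {F. length F = Suc (length \<beta>) \<and>
         (\<forall>i\<le>length \<beta>. subalgebra E (F ! i) R \<and> card (F ! i) = q ^ psum \<beta> i) \<and>
         (\<forall>i<length \<beta>. F ! i \<subseteq> F ! Suc i)}"

lemma prod_multiples_lessThan:
  fixes f :: "nat \<Rightarrow> 'a::comm_monoid_mult"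
  assumes "e > 0" "e dvd b"
  shows "(\<Prod>j\<in>{j. j < b \<and> e dvd j}. f j) = (\<Prod>k<b div e. f (e * k))"
proof (rule prod.reindex_bij_witness[where i = "\<lambda>k. e * k" and j = "\<lambda>j. j div e"])
  fix k assume "k \<in> {..<b div e}"
  then show "e * k \<in> {j. j < b \<and> e dvd j}"
    using assms by (auto elim!: dvdE)
qed (use assms in \<open>auto elim!: dvdE\<close>)

lemma psum_snoc: "i \<le> length \<beta> \<Longrightarrow> psum (\<beta> @ [b]) i = psum \<beta> i"
  by (simp add: psum_def)

lemma psum_length: "psum \<beta> (length \<beta>) = sum_list \<beta>"
  by (simp add: psum_def)

context field
begin

text \<open>A flag is fixed exactly when each of its members is, and being fixed by \<open>c\<close>
  means being a subspace over the field generated by \<open>K\<close> and \<open>c\<close>.\<close>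

lemma fixed_flags_eq_towers:
  assumes fin: "finite (carrier R)" and K: "subfield K R" and c: "c \<in> carrier R - {\<zero>}"
  shows "{F \<in> flags R K \<beta>. map (\<lambda>V. c <# V) F = F}
       = towers R (generate_field R (insert c K)) (card K) \<beta>"
proof -
  let ?E = "generate_field R (insert c K)"
  have E: "subalgebra K V R" if "subalgebra ?E V R" for V
  proof -
    have "K \<subseteq> ?E" by (auto intro: generate_field.incl)
    then show ?thesis using that unfolding subalgebra_def subalgebra_axioms_def by blast
  qed
  have *: "subalgebra K V R \<and> dimension n K V \<and> c <# V = V
      \<longleftrightarrow> subalgebra ?E V R \<and> card V = card K ^ n" for V n
    using E dimension_iff_card[OF fin K] l_coset_eq_iff_subalgebra_generate_field[OF fin K _ c]
    by blast
  have "map (\<lambda>V. c <# V) F = F \<longleftrightarrow> (\<forall>i\<le>length \<beta>. c <# F ! i = F ! i)"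
    if "length F = Suc (length \<beta>)" for F
    using that by (auto simp: list_eq_iff_nth_eq less_Suc_eq_le)
  then have fl: "F \<in> flags R K \<beta> \<and> map (\<lambda>V. c <# V) F = F \<longleftrightarrow> length F = Suc (length \<beta>)
      \<and> (\<forall>i\<le>length \<beta>. subalgebra K (F ! i) R \<and> dimension (psum \<beta> i) K (F ! i) \<and> c <# F ! i = F ! i)
      \<and> (\<forall>i<length \<beta>. F ! i \<subseteq> F ! Suc i)" for F
    unfolding flags_def mem_Collect_eq by meson
  show ?thesis
    unfolding towers_def by (intro Collect_cong) (simp only: fl *)
qed

lemma finite_towers:
  assumes "finite (carrier R)"
  shows "finite (towers R E q \<beta>)"
proof (rule finite_subset)
  show "towers R E q \<beta> \<subseteq> {F. set F \<subseteq> Pow (carrier R) \<and> length F = Suc (length \<beta>)}"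
    by (auto simp: towers_def in_set_conv_nth less_Suc_eq_le dest!: subalgebra_in_carrier)
      (metis subalgebra_in_carrier subsetD)
  show "finite {F. set F \<subseteq> Pow (carrier R) \<and> length F = Suc (length \<beta>)}"
    using assms by (intro finite_lists_length_eq) simp
qed

text \<open>Prepares the induction on the last part: a tower is a shorter tower followed by a
  superspace of its last member.\<close>

lemma towers_snoc:
  "towers R E q (\<beta> @ [b]) = (\<lambda>(F, W). F @ [W]) `
     (SIGMA F:towers R E q \<beta>. {W. subalgebra E W R \<and> last F \<subseteq> W \<and> card W = q ^ (sum_list \<beta> + b)})"
    (is "?L = ?f ` ?S")
proof
  show "?f ` ?S \<subseteq> ?L"
  proof clarify
    fix F W assume F: "F \<in> towers R E q \<beta>" and W: "subalgebra E W R" "last F \<subseteq> W" "card W = q ^ (sum_list \<beta> + b)"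
    have l: "length F = Suc (length \<beta>)" using F by (simp add: towers_def)
    then have "last F = F ! length \<beta>" by (simp add: last_conv_nth flip: length_0_conv)
    with F W l show "F @ [W] \<in> ?L"
      by (auto simp: towers_def nth_append psum_snoc less_Suc_eq le_Suc_eq psum_def[of _ "Suc (length \<beta>)"])
  qed
  show "?L \<subseteq> ?f ` ?S"
  proof
    fix G assume G: "G \<in> ?L"
    then have l: "length G = Suc (Suc (length \<beta>))" by (simp add: towers_def)
    then obtain F W where FW: "G = F @ [W]" by (cases G rule: rev_cases) auto
    have lF: "length F = Suc (length \<beta>)" using l FW by simp
    then have la: "last F = F ! length \<beta>" by (simp add: last_conv_nth flip: length_0_conv)
    have n: "G ! i = F ! i" if "i \<le> length \<beta>" for i using that lF by (simp add: FW nth_append)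
    have W: "G ! Suc (length \<beta>) = W" using lF by (simp add: FW nth_append)
    have sub: "subalgebra E (G ! i) R" and crd: "card (G ! i) = q ^ psum (\<beta> @ [b]) i"
      if "i \<le> Suc (length \<beta>)" for i using G that by (auto simp: towers_def)
    have inc: "G ! i \<subseteq> G ! Suc i" if "i < Suc (length \<beta>)" for i
      using G that by (auto simp: towers_def)
    have "F \<in> towers R E q \<beta>"
      unfolding towers_def using sub crd inc lF
      by (auto simp: n[symmetric] psum_snoc)
    moreover have "subalgebra E W R" "last F \<subseteq> W" "card W = q ^ (sum_list \<beta> + b)"
      using sub[of "Suc (length \<beta>)"] crd[of "Suc (length \<beta>)"] inc[of "length \<beta>"]
      by (auto simp: W n la psum_def)
    ultimately show "G \<in> ?f ` ?S" unfolding FW by force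
  qed
qed

text \<open>By \<open>card_superspaces\<close> over \<open>E\<close>, the number of choices for the
  last member is the same for every shorter tower, so the counts multiply along \<beta>.\<close>

lemma card_towers:
  assumes fin: "finite (carrier R)" and E: "subfield E R" "card E = q ^ e" "0 < e"
    and L: "card (carrier R) = q ^ m"
    and dvd: "\<And>i. i < length \<beta> \<Longrightarrow> e dvd \<beta> ! i"
  shows "card (towers R E q \<beta>)
        * (\<Prod>i<length \<beta>. \<Prod>j\<in>{j. j < \<beta> ! i \<and> e dvd j}. den_exp q \<beta> (i, j))
      = (\<Prod>i<length \<beta>. \<Prod>j\<in>{j. j < \<beta> ! i \<and> e dvd j}. num_exp q m \<beta> (i, j))"
  using dvd
proof (induction \<beta> rule: rev_induct)
  case Nil
  have "towers R E q [] = {[{\<zero>}]}"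
  proof -
    have "V = {\<zero>}" if V: "subalgebra E V R" "card V = 1" for V
      using V(2) subgroup.one_closed[OF subalgebra.axioms(1)[OF V(1)]]
      by (auto simp: card_1_singleton_iff)
    moreover have "subalgebra E {\<zero>} R"
      by (intro finite_dimension_imp_subalgebra[OF E(1)] finite_dimensionI) (rule zero_dim)
    ultimately have V0: "subalgebra E V R \<and> card V = 1 \<longleftrightarrow> V = {\<zero>}" for V
      by (metis is_singletonI is_singleton_altdef)
    have "F \<in> towers R E q [] \<longleftrightarrow> (\<exists>V. F = [V] \<and> subalgebra E V R \<and> card V = 1)" for F
      unfolding towers_def by (cases F) (auto simp: psum_def)
    then show ?thesis unfolding V0 by blast
  qed
  then show ?case by simp
next
  case (snoc b \<beta>)
  let ?s = "sum_list \<beta>"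
  define D where "D \<beta> i = (\<Prod>j\<in>{j. j < \<beta> ! i \<and> e dvd j}. den_exp q \<beta> (i, j))" for \<beta> i
  define N where "N \<beta> i = (\<Prod>j\<in>{j. j < \<beta> ! i \<and> e dvd j}. num_exp q m \<beta> (i, j))" for \<beta> i
  define S where "S F = {W. subalgebra E W R \<and> last F \<subseteq> W \<and> card W = q ^ (?s + b)}" for F
  have eb: "e dvd b" using snoc.prems[of "length \<beta>"] by simp
  have e\<beta>: "e dvd \<beta> ! i" if "i < length \<beta>" for i
    using snoc.prems[of i] that by (simp add: nth_append)
  have DN: "D (\<beta> @ [b]) i = D \<beta> i" "N (\<beta> @ [b]) i = N \<beta> i" if "i < length \<beta>" for i
    using that by (simp_all add: D_def N_def den_exp_def num_exp_def nth_append psum_snoc)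
  have SF: "card (S F) * D (\<beta> @ [b]) (length \<beta>) = N (\<beta> @ [b]) (length \<beta>)"
    if F: "F \<in> towers R E q \<beta>" for F
  proof -
    have "last F = F ! length \<beta>"
      using F by (auto simp: towers_def last_conv_nth simp flip: length_0_conv)
    then have V: "subalgebra E (last F) R" "card (last F) = q ^ ?s"
      using F by (auto simp: towers_def psum_length)
    have be: "e * (b div e) = b" using eb by simp
    \<comment> \<open>The substitution \<open>j = e * k\<close> rewrites the products in powers of
      \<open>q ^ e = card E\<close>, the form in which superspaces are counted.\<close>
    have "D (\<beta> @ [b]) (length \<beta>) = (\<Prod>k<b div e. q ^ ?s * (q ^ e) ^ (b div e) - q ^ ?s * (q ^ e) ^ k)"
      using prod_multiples_lessThan[OF E(3) eb]
      by (simp add: D_def den_exp_def psum_def power_add be flip: power_mult)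
    moreover have "N (\<beta> @ [b]) (length \<beta>) = (\<Prod>k<b div e. q ^ m - q ^ ?s * (q ^ e) ^ k)"
      using prod_multiples_lessThan[OF E(3) eb]
      by (simp add: N_def num_exp_def psum_def power_add flip: power_mult)
    moreover have "S F = {W. subalgebra E W R \<and> last F \<subseteq> W \<and> card W = card (last F) * card E ^ (b div e)}"
      by (simp add: S_def V E(2) power_add be flip: power_mult)
    ultimately show ?thesis
      using card_superspaces[OF fin E(1) V(1), of "b div e"] by (simp add: V(2) E(2) L)
  qed
  have finS: "finite (S F)" for F
    by (rule finite_subset[of _ "Pow (carrier R)"]) (auto simp: S_def fin dest: subalgebra_in_carrier)
  have "towers R E q (\<beta> @ [b]) = (\<lambda>(F, W). F @ [W]) ` (SIGMA F:towers R E q \<beta>. S F)"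
    unfolding S_def by (rule towers_snoc)
  then have "card (towers R E q (\<beta> @ [b])) = card (SIGMA F:towers R E q \<beta>. S F)"
    by (simp add: card_image inj_on_def)
  also have "\<dots> = (\<Sum>F\<in>towers R E q \<beta>. card (S F))"
    using finite_towers[OF fin] finS by simp
  finally have "card (towers R E q (\<beta> @ [b])) * D (\<beta> @ [b]) (length \<beta>)
      = card (towers R E q \<beta>) * N (\<beta> @ [b]) (length \<beta>)"
    by (simp add: sum_distrib_right SF)
  moreover have "card (towers R E q \<beta>) * (\<Prod>i<length \<beta>. D \<beta> i) = (\<Prod>i<length \<beta>. N \<beta> i)"
    unfolding D_def N_def by (rule snoc.IH) (rule e\<beta>)
  ultimately have "card (towers R E q (\<beta> @ [b])) * (\<Prod>i<Suc (length \<beta>). D (\<beta> @ [b]) i)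
      = (\<Prod>i<Suc (length \<beta>). N (\<beta> @ [b]) i)"
    by (simp add: DN) (metis mult.assoc mult.commute)
  then show ?case by (simp add: D_def N_def)
qed

text \<open>The size of an \<open>E\<close>-subspace is a power of \<open>q ^ e\<close>, so in a
  tower \<open>e\<close> divides every partial sum and hence every part.\<close>

lemma towers_eq_empty:
  assumes fin: "finite (carrier R)" and E: "subfield E R" "card E = q ^ e" and q: "2 \<le> q"
    and nd: "i < length \<beta>" "\<not> e dvd \<beta> ! i"
  shows "towers R E q \<beta> = {}"
proof -
  have False if F: "F \<in> towers R E q \<beta>" for F
  proof -
    have "e dvd psum \<beta> i" if i: "i \<le> length \<beta>" for i
    proof -
      have V: "subalgebra E (F ! i) R" "card (F ! i) = q ^ psum \<beta> i"
        using F i by (auto simp: towers_def)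
      obtain k where "dimension k E (F ! i)"
        using finite_dimension_if_finite[OF fin E(1) V(1)] by auto
      then have "q ^ psum \<beta> i = q ^ (e * k)"
        using card_eq_power_dimension[OF E(1)] V(2) E(2) by (simp add: power_mult)
      then show ?thesis using q by simp
    qed
    from this[of i] this[of "Suc i"] nd show False
      by (simp add: psum_Suc dvd_add_right_iff)
  qed
  then show ?thesis by blast
qed

text \<open>The hypothesis on \<open>w\<close> says that \<open>w\<close> and \<open>c\<close> have
  the same order, so the field-theoretic criterion for powers of \<open>c\<close> becomes one for
  powers of \<open>w\<close>. Both sides are 0 unless \<open>e\<close> divides all parts; otherwise
  they satisfy the same equation after multiplication by the denominator.\<close>

lemma card_fixed_flags:
  assumes p: "Factorial_Ring.prime p" and K: "subfield K R" "card K = p ^ k"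
    and L: "card (carrier R) = card K ^ m" "m > 0"
    and c: "c \<in> carrier R - {\<zero>}" and w: "\<And>n::nat. w ^ n = 1 \<longleftrightarrow> c [^] n = \<one>"
    and \<beta>: "\<beta> \<in> sub_compositions \<alpha> m"
  shows "of_nat (card {F \<in> flags R K \<beta>. map (\<lambda>V. c <# V) F = F})
       = w ^ (\<Sum>i<length \<alpha>. (\<alpha> ! i - \<beta> ! i) * (card K ^ m - card K ^ psum \<beta> (Suc i)))
         * eval_complex (qt_multinomial (card K) m \<beta>) w"
proof -
  let ?q = "card K"
  define E where "E = generate_field R (insert c K)"
  have len: "length \<beta> = length \<alpha>" and le: "sum_list \<beta> \<le> m"
    using \<beta> by (auto simp: sub_compositions_def dest: list_all2_lengthD)
  have fin: "finite (carrier R)"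
    using L K prime_gt_0_nat[OF p] by (intro card_ge_0_finite) simp
  have Kc: "insert c K \<subseteq> carrier R" using subfieldE(3)[OF K(1)] c by auto
  have Es: "subfield E R" unfolding E_def using Kc by (rule generate_field_is_subfield)
  have q2: "2 \<le> ?q" using fin K(1) by (rule card_subfield_ge_2)
  have "subalgebra K E R"
  proof -
    have "K \<subseteq> E" unfolding E_def by (auto intro: generate_field.incl)
    then show ?thesis
      using subring.axioms(1)[OF subfieldE(1)[OF Es]] subringE(6)[OF subfieldE(1)[OF Es]]
      unfolding subalgebra_def subalgebra_axioms_def by blast
  qed
  then obtain e where e: "card E = ?q ^ e"
    using finite_dimension_if_finite[OF fin K(1)] card_eq_power_dimension[OF K(1)] by blast
  have e0: "0 < e" using card_subfield_ge_2[OF fin Es] e by (cases e) auto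
  have root: "w ^ (?q ^ a - ?q ^ b) = 1 \<longleftrightarrow> e dvd a - b" if "b \<le> a" for a b
    unfolding w using that e unfolding E_def
    by (intro pow_diff_eq_one_iff_degree_dvd[OF p L K c]) auto
  \<comment> \<open>Lagrange gives exponent \<open>?q ^ m - 1\<close>; writing 1 as
    \<open>?q ^ 0\<close> lets \<open>root\<close> yield \<open>e dvd m\<close>.\<close>
  have "c [^] (?q ^ m - ?q ^ 0) = \<one>"
    using order_mult_of[OF fin] group.pow_order_eq_1[OF field_mult_group, of c] c L
    by (simp add: Coset.order_def nat_pow_mult_of)
  then have em: "e dvd m" using root[of 0 m] w by simp
  have fixed: "{F \<in> flags R K \<beta>. map (\<lambda>V. c <# V) F = F} = towers R E ?q \<beta>"
    unfolding E_def by (rule fixed_flags_eq_towers[OF fin K(1) c])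
  show ?thesis
  proof (cases "\<exists>i<length \<beta>. \<not> e dvd \<beta> ! i")
    case True
    then have "towers R E ?q \<beta> = {}" using towers_eq_empty[OF fin Es e q2] by blast
    then show ?thesis
      using eval_qt_multinomial_eq_0[OF q2 e0 em le root True] unfolding fixed by simp
  next
    case False
    then have dvd: "e dvd \<beta> ! i" if "i < length \<beta>" for i using that by blast
    have "w ^ ((\<alpha> ! i - \<beta> ! i) * (?q ^ m - ?q ^ psum \<beta> (Suc i))) = 1" if "i < length \<alpha>" for i
    proof -
      have "psum \<beta> (Suc i) \<le> m" using psum_le_sum_list le by (rule order_trans)
      moreover have "e dvd m - psum \<beta> (Suc i)"
        using dvd_psum[of \<beta> e "Suc i"] dvd that len em by (simp add: dvd_diff_nat)
      ultimately have "w ^ (?q ^ m - ?q ^ psum \<beta> (Suc i)) = 1" using root by simp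
      then show ?thesis by (simp add: power_mult mult.commute[of "\<alpha> ! i - _"])
    qed
    then have one: "w ^ (\<Sum>i<length \<alpha>. (\<alpha> ! i - \<beta> ! i) * (?q ^ m - ?q ^ psum \<beta> (Suc i))) = 1"
      by (simp add: power_sum)
    define D where "D = (\<Prod>i<length \<beta>. \<Prod>j\<in>{j. j < \<beta> ! i \<and> e dvd j}. den_exp ?q \<beta> (i, j))"
    \<comment> \<open>Positivity permits cancelling \<open>D\<close> from the two multiplied-out
      formulas.\<close>
    have "D > 0"
      unfolding D_def by (intro prod_pos ballI den_exp_pos[OF q2 e0 em le root]) auto
    moreover have "eval_complex (qt_multinomial ?q m \<beta>) w * of_nat D = of_nat (card (towers R E ?q \<beta>)) * of_nat D"
      using eval_qt_multinomial_mult_eq[OF q2 e0 em le root dvd, folded D_def]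
        card_towers[OF fin Es e e0 L(1) dvd, folded D_def] by (metis of_nat_mult)
    ultimately show ?thesis unfolding fixed one by simp
  qed
qed

lemma finite_flags:
  assumes "finite (carrier R)"
  shows "finite (flags R K \<beta>)"
proof (rule finite_subset)
  show "flags R K \<beta> \<subseteq> {F. set F \<subseteq> Pow (carrier R) \<and> length F = Suc (length \<beta>)}"
    by (auto simp: flags_def in_set_conv_nth less_Suc_eq_le) (metis subalgebra_in_carrier subsetD)
  show "finite {F. set F \<subseteq> Pow (carrier R) \<and> length F = Suc (length \<beta>)}"
    using assms by (intro finite_lists_length_eq) simp
qed

lemma card_fixed_partial_flags:
  assumes p: "Factorial_Ring.prime p" and K: "subfield K R" "card K = p ^ k"
    and L: "card (carrier R) = card K ^ m" "m > 0"
    and c: "c \<in> carrier R - {\<zero>}" and w: "\<And>n::nat. w ^ n = 1 \<longleftrightarrow> c [^] n = \<one>"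
  shows "of_nat (card {F \<in> partial_flags R K \<alpha> m. map (\<lambda>V. c <# V) F = F})
       = eval_complex (C_poly (card K) \<alpha> m) w"
proof -
  have fin: "finite (carrier R)"
    using L K prime_gt_0_nat[OF p] by (intro card_ge_0_finite) simp
  let ?X = "\<lambda>\<beta>. {F \<in> flags R K \<beta>. map (\<lambda>V. c <# V) F = F}"
  have "{F \<in> partial_flags R K \<alpha> m. map (\<lambda>V. c <# V) F = F} = (\<Union>\<beta>\<in>sub_compositions \<alpha> m. ?X \<beta>)"
    by (auto simp: partial_flags_def)
  also have "card \<dots> = (\<Sum>\<beta>\<in>sub_compositions \<alpha> m. card (?X \<beta>))"
    using disjoint_family_flags[OF field_axioms K(1), of \<alpha> m] finite_flags[OF fin, of K]
    by (intro card_UN_disjoint finite_sub_compositions) (auto simp: disjoint_family_on_def)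
  finally show ?thesis
    using card_fixed_flags[OF p K L c w]
    by (simp add: C_poly_def eval_complex_simps)
qed

section \<open>Multiplication as a group action on partial flags\<close>

lemma l_coset_one: "V \<subseteq> carrier R \<Longrightarrow> \<one> <# V = V"
  by (force simp: l_coset_def)

lemma l_coset_mult:
  "V \<subseteq> carrier R \<Longrightarrow> c \<in> carrier R \<Longrightarrow> d \<in> carrier R \<Longrightarrow> (c \<otimes> d) <# V = c <# (d <# V)"
  by (force simp: l_coset_def m_assoc subset_iff)

lemma subalgebra_l_coset:
  assumes K: "K \<subseteq> carrier R" and V: "subalgebra K V R" and c: "c \<in> carrier R"
  shows "subalgebra K (c <# V) R"
proof -
  have Vc: "v \<in> carrier R" if "v \<in> V" for v using subalgebra_in_carrier[OF V] that by blast
  note s = add.subgroupE[OF subalgebra.axioms(1)[OF V]]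
  have "subgroup (c <# V) (add_monoid R)"
  proof (rule add.subgroupI)
    show "c <# V \<subseteq> carrier R" "c <# V \<noteq> {}"
      using c s(2) Vc by (auto simp: l_coset_def)
    show "\<ominus> x \<in> c <# V" if "x \<in> c <# V" for x
      using that c s(3) Vc by (force simp: l_coset_def r_minus[symmetric])
    show "x \<oplus> y \<in> c <# V" if "x \<in> c <# V" "y \<in> c <# V" for x y
      using that c s(4) Vc by (force simp: l_coset_def r_distr[symmetric])
  qed
  moreover have "k \<otimes> x \<in> c <# V" if k: "k \<in> K" and x: "x \<in> c <# V" for k x
  proof -
    obtain v where v: "v \<in> V" "x = c \<otimes> v" using x by (auto simp: l_coset_def)
    then have "k \<otimes> x = c \<otimes> (k \<otimes> v)" using Vc c k K by (simp add: m_lcomm subset_iff)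
    then show ?thesis using subalgebra.smult_closed[OF V k v(1)] by (auto simp: l_coset_def)
  qed
  ultimately show ?thesis unfolding subalgebra_def subalgebra_axioms_def by blast
qed

text \<open>Multiplication by a nonzero \<open>c\<close> preserves subspaces, inclusions and
  cardinalities, hence also dimensions.\<close>

lemma map_l_coset_flags:
  assumes fin: "finite (carrier R)" and K: "subfield K R" and c: "c \<in> carrier R - {\<zero>}"
    and F: "F \<in> flags R K \<beta>"
  shows "map (\<lambda>V. c <# V) F \<in> flags R K \<beta>"
proof -
  have "subalgebra K (c <# V) R \<and> dimension n K (c <# V)"
    if V: "subalgebra K V R" "dimension n K V" for V n
  proof -
    have s: "subalgebra K (c <# V) R"
      using subfieldE(3)[OF K] V(1) c by (intro subalgebra_l_coset) auto
    then show ?thesis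
      using V card_l_coset[OF subalgebra_in_carrier[OF V(1)] c] by (simp add: dimension_iff_card[OF fin K])
  qed
  moreover have "c <# V \<subseteq> c <# W" if "V \<subseteq> W" for V W
    using that by (auto simp: l_coset_def)
  ultimately show ?thesis using F by (auto simp: flags_def)
qed

lemma group_action_flag_action:
  assumes fin: "finite (carrier R)" and K: "subfield K R"
  shows "group_action (mult_of R) (partial_flags R K \<alpha> m) (flag_action R K \<alpha> m)"
proof -
  let ?X = "partial_flags R K \<alpha> m" and ?\<phi> = "flag_action R K \<alpha> m"
  interpret M: group "mult_of R" by (rule field_mult_group)
  have V: "V \<subseteq> carrier R" if X: "F \<in> ?X" and F: "V \<in> set F" for F V
  proof -
    obtain \<beta> where \<beta>: "F \<in> flags R K \<beta>" using X by (auto simp: partial_flags_def)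
    obtain i where "i < length F" "V = F ! i" using F by (auto simp: in_set_conv_nth)
    then have "subalgebra K V R" using \<beta> by (simp add: flags_def)
    then show ?thesis by (rule subalgebra_in_carrier)
  qed
  have closed: "?\<phi> c F \<in> ?X" if "c \<in> carrier (mult_of R)" "F \<in> ?X" for c F
    using that map_l_coset_flags[OF fin K] by (auto simp: flag_action_def partial_flags_def)
  have mult: "?\<phi> (c \<otimes> d) F = ?\<phi> c (?\<phi> d F)"
    if "c \<in> carrier (mult_of R)" "d \<in> carrier (mult_of R)" "F \<in> ?X" for c d F
    using that closed[of d F] V by (auto simp: flag_action_def l_coset_mult)
  have one: "?\<phi> \<one> F = F" if "F \<in> ?X" for F
    using that V by (auto simp: flag_action_def l_coset_one intro!: map_idI)
  have bij: "?\<phi> c \<in> Bij ?X" if c: "c \<in> carrier (mult_of R)" for c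
  proof -
    define d where "d = inv\<^bsub>mult_of R\<^esub> c"
    have d: "d \<in> carrier (mult_of R)" "d \<otimes> c = \<one>" "c \<otimes> d = \<one>"
      using M.inv_closed[OF c] M.l_inv[OF c] M.r_inv[OF c] by (simp_all add: d_def)
    \<comment> \<open>The action of the inverse element \<open>d\<close> is the inverse map.\<close>
    have "bij_betw (?\<phi> c) ?X ?X"
      by (rule bij_betw_byWitness[where f' = "?\<phi> d"])
        (use closed c d mult[of c d] mult[of d c] one in auto)
    then show ?thesis by (simp add: Bij_def flag_action_def)
  qed
  have "?\<phi> \<in> hom (mult_of R) (BijGroup ?X)"
  proof (rule homI)
    fix c d assume c: "c \<in> carrier (mult_of R)" "d \<in> carrier (mult_of R)"
    have "?\<phi> (c \<otimes> d) = compose ?X (?\<phi> c) (?\<phi> d)"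
      by (rule extensionalityI[of _ ?X]) (use c mult in \<open>auto simp: compose_eq flag_action_def\<close>)
    then show "?\<phi> (c \<otimes>\<^bsub>mult_of R\<^esub> d) = ?\<phi> c \<otimes>\<^bsub>BijGroup ?X\<^esub> ?\<phi> d"
      using bij c by (simp add: BijGroup_def)
  qed (use bij in \<open>simp add: BijGroup_def\<close>)
  then show ?thesis
    unfolding group_action_def group_hom_def group_hom_axioms_def
    using M.group_axioms group_BijGroup by blast
qed

end

section \<open>Matching powers of the generator with powers of the root of unity\<close>

text \<open>Primitivity only speaks of exponents strictly between 0 and \<open>N\<close>, so the
  integer \<open>d\<close> is first reduced modulo \<open>N\<close>.\<close>

lemma primitive_root_powi_eq_1_iff:
  assumes z: "primitive_root_of_unity N z" and N: "N > 0"
  shows "z powi d = 1 \<longleftrightarrow> int N dvd d"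
proof -
  have zN: "z ^ N = 1" and min: "\<And>k. 0 < k \<Longrightarrow> k < N \<Longrightarrow> z ^ k \<noteq> 1"
    using z by (auto simp: primitive_root_of_unity_def)
  then have z0: "z \<noteq> 0" using N by (auto simp: zero_power)
  define r where "r = nat (d mod int N)"
  have r: "d mod int N = int r" "r < N" using N by (auto simp: r_def nat_less_iff)
  have "z powi d = z powi (int N * (d div int N) + int r)"
    by (simp flip: r(1))
  also have "\<dots> = (z powi int N) powi (d div int N) * z powi int r"
    using z0 by (simp add: power_int_add power_int_mult)
  also have "\<dots> = z ^ r" using zN by simp
  finally have "z powi d = 1 \<longleftrightarrow> r = 0" using min[of r] r(2) by auto
  then show ?thesis using r by (simp add: dvd_eq_mod_eq_0)
qed

lemma (in group) ord_cyclic_generator: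
  assumes "cyclic_generator G g"
  shows "ord g = Coset.order G"
  using assms generate_pow_card[of g] by (simp add: cyclic_generator_def Coset.order_def)

lemma (in field) of_nat_card_fixed_eq_eval:
  fixes d :: int
  assumes q: "primepow q" and m: "m \<ge> 1" and L: "card (carrier R) = q ^ m"
    and K: "subfield K R" "card K = q"
    and g: "cyclic_generator (mult_of R) \<gamma>" and z: "primitive_root_of_unity (q ^ m - 1) \<zeta>"
  shows "of_nat (card {x \<in> partial_flags R K \<alpha> m.
            flag_action R K \<alpha> m (\<gamma> [^]\<^bsub>mult_of R\<^esub> d) x = x})
          = eval_complex (C_poly q \<alpha> m) (\<zeta> powi d)"
proof -
  interpret M: group "mult_of R" by (rule field_mult_group)
  obtain p k where p: "Factorial_Ring.prime p" "q = p ^ k" using q by (auto simp: primepow_def)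
  have fin: "finite (carrier R)"
    using L p prime_gt_0_nat[of p] by (intro card_ge_0_finite) simp
  have q2: "2 \<le> q" using card_subfield_ge_2[OF fin K(1)] K(2) by simp
  then have N: "q ^ m - 1 > 0" using m one_less_power[of q m] by simp
  have ord: "M.ord \<gamma> = q ^ m - 1"
    using M.ord_cyclic_generator[OF g] order_mult_of[OF fin] L by (simp add: Coset.order_def)
  have gc: "\<gamma> \<in> carrier (mult_of R)" using g by (simp add: cyclic_generator_def)
  define c where "c = \<gamma> [^]\<^bsub>mult_of R\<^esub> d"
  have c: "c \<in> carrier R - {\<zero>}" using M.int_pow_closed[OF gc] by (simp add: c_def)
  \<comment> \<open>Both conditions say that \<open>q ^ m - 1\<close> divides \<open>d * n\<close>,
    which also covers negative \<open>d\<close>.\<close>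
  have w: "(\<zeta> powi d) ^ n = 1 \<longleftrightarrow> c [^] n = \<one>" for n :: nat
  proof -
    have "c [^] n = \<gamma> [^]\<^bsub>mult_of R\<^esub> (d * int n)"
      using M.int_pow_pow[OF gc, of d "int n"] by (simp add: c_def int_pow_int nat_pow_mult_of)
    then have "c [^] n = \<one> \<longleftrightarrow> int (q ^ m - 1) dvd d * int n"
      using M.int_pow_eq_id[OF gc] ord by simp
    moreover have "(\<zeta> powi d) ^ n = \<zeta> powi (d * int n)"
      by (simp add: power_int_mult)
    ultimately show ?thesis using primitive_root_powi_eq_1_iff[OF z N] by simp
  qed
  \<comment> \<open>On partial flags the restricted action agrees with the plain
    \<open>map\<close>.\<close>
  have "{x \<in> partial_flags R K \<alpha> m. flag_action R K \<alpha> m c x = x}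
      = {x \<in> partial_flags R K \<alpha> m. map (\<lambda>V. c <# V) x = x}"
    by (auto simp: flag_action_def)
  then show ?thesis
    using card_fixed_partial_flags[OF p(1) K(1) _ _ _ c w] L K p m unfolding c_def by simp
qed

theorem proposition6p18:
  fixes L :: "('a, 'b) ring_scheme" and K :: "'a set"
    and q n m :: nat and \<alpha> :: "nat list" and d :: int
    and \<gamma> :: 'a and \<zeta> :: complex
  assumes "primepow q" and "n \<ge> 1" and "m \<ge> 1"
    and "field L" and "card (carrier L) = q ^ m"
    and "subfield K L" and "card K = q"
    and "composition n \<alpha>"
    and "cyclic_generator (mult_of L) \<gamma>"
    and "primitive_root_of_unity (q ^ m - 1) \<zeta>"
  shows "of_nat (card {x \<in> partial_flags L K \<alpha> m.
            flag_action L K \<alpha> m (\<gamma> [^]\<^bsub>mult_of L\<^esub> d) x = x})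
          = eval_complex (C_poly q \<alpha> m) (\<zeta> powi d)
       \<and> exhibits_cyclic_sieving (mult_of L) (partial_flags L K \<alpha> m) (flag_action L K \<alpha> m)
          (C_poly q \<alpha> m)"
proof -
  interpret field L by fact
  interpret M: group "mult_of L" by (rule field_mult_group)
  \<comment> \<open>The generator, the root and the exponent are left open, because cyclic sieving
    quantifies over all of them.\<close>
  note eval = of_nat_card_fixed_eq_eval[OF assms(1,3,5,6,7)]
  have "q > 0" using assms(1) by (rule primepow_gt_0_nat)
  then have fin: "finite (carrier L)"
    using assms(5) by (intro card_ge_0_finite) simp
  have order: "Coset.order (mult_of L) = q ^ m - 1"
    using order_mult_of[OF fin] assms(5) by (simp add: Coset.order_def)
  have "\<gamma> \<in> carrier (mult_of L)" and "carrier (mult_of L) = range (\<lambda>k::int. \<gamma> [^]\<^bsub>mult_of L\<^esub> k)"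
    using assms(9) M.generate_pow[of \<gamma>] unfolding cyclic_generator_def by auto
  then have "cyclic_group (mult_of L)"
    unfolding M.cyclic_group by blast
  moreover have "finite (partial_flags L K \<alpha> m)"
    unfolding partial_flags_def
    by (intro finite_UN_I finite_sub_compositions finite_flags fin)
  ultimately have "exhibits_cyclic_sieving (mult_of L) (partial_flags L K \<alpha> m)
      (flag_action L K \<alpha> m) (C_poly q \<alpha> m)"
    unfolding exhibits_cyclic_sieving_def invariants_def order
    using finite_mult_of[OF fin] group_action_flag_action[OF fin assms(6)] eval by blast
  then show ?thesis using eval[OF assms(9,10)] by blast
qed

end
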